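(* Consider a reversing Petri net and two executions $\langle M,H\rangle \xrightarrow{\sigma_1} \langle M_1,H_1\rangle$ and $\langle M,H\rangle \xrightarrow{\sigma_2} \langle M_2,H_2\rangle$, each consisting of forward transitions and causal-order reverse transitions. Then $\sigma_1\asymp\sigma_2$ if and only if $\langle M_1,H_1\rangle\asymp\langle M_2,H_2\rangle$.
   Context: A reversing Petri net (RPN) $(A,P,B,T,F)$ consists of a finite set $A$ of uniquely named tokens (bases), a finite set $P$ of places, a set $B\subseteq A\times A$ of undirected bonds, a finite set $T$ of transitions, and arcs $F:(P\times T\cup T\times P)\to 2^{A\cup \overline{A}\cup B\cup\overline{B}}$ whose labels state which tokens/bonds a transition requires (incoming arcs, negative items expressing absence) and where they are placed (outgoing arcs). The net is well-formed (transitions neither create nor erase tokens, do not destroy bonds, and do not clone tokens/bonds into several outgoing places), and in the initial marking each token lies in exactly one place. A state is $\langle M,H\rangle$ (extended with a causal dependence relation $\prec$, empty initially), where the marking $M:P\to 2^{A\cup B}$ distributes tokens and bonds over places and the history $H:T\to 2^{\mathbb N}$ records, for each transition, the keys of its executed and not-yet-reversed occurrences. Forward firing of an enabled $t$ moves the required tokens/bonds together with their connected components from input to output places, creates the bonds of $\mathrm{effect}(t)$ (labels on outgoing arcs minus labels on incoming arcs), and adds to $H(t)$ the key $k=1+\max$ of all keys in use. The new occurrence $(t,k)$ causally depends on an earlier occurrence $(t',k')$, written $(t',k')\prec(t,k)$, if $k'<k$ and some token used to fire $(t,k)$ lies in a connected component containing tokens/bonds on the outgoing arcs of $t'$. Causal-order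 reversal of $t$ (written $\underline t$) is allowed when all tokens/bonds on the outgoing arcs of $t$ are present in its output places and no occurrence depends causally on $(t,\max H(t))$; it moves these tokens/bonds with their components back to the input places, destroys the bonds in $\mathrm{effect}(t)$, removes $\max H(t)$ from $H(t)$ and removes that occurrence from $\prec$. A causal path is a sequence of occurrences each causally preceding the next; two histories are causally equivalent if they have the same causal paths up to the numeric keys, and $\langle M,H\rangle\asymp\langle M',H'\rangle$ means $M=M'$ and $H$, $H'$ causally equivalent. Two actions are concurrent in a state if each can be executed after the other and both orders yield causally equivalent states. Causal equivalence of traces $\asymp$ is the least equivalence closed under composition of traces such that $\alpha_1;\alpha_2\asymp\alpha_2;\alpha_1$ for concurrent $\alpha_1,\alpha_2$ and $\alpha;\underline{\alpha}\asymp\epsilon$. *)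

theory Defs
  imports Main "HOL-Library.Uprod"
begin

section \<open>Reversing Petri nets\<close>

text \<open>Bonds are undirected, hence unordered pairs of tokens. The type \<open>signed\<close> adds the
  negative instances of tokens and bonds that may occur in arc labels.\<close>

datatype 'a item = Tok 'a | Bond "'a uprod"

datatype 'i signed = Pos 'i | Neg 'i

type_synonym 'a label = "'a item signed set"

text \<open>The field \<open>arcs\<close> is the map F on the disjoint union of P x T and T x P.\<close>

record ('a, 'p, 't) rpn =
  tokens :: "'a set"
  places :: "'p set"
  bonds :: "'a uprod set"
  transitions :: "'t set"
  arcs :: "('p \<times> 't) + ('t \<times> 'p) \<Rightarrow> 'a label"

definition in_arc :: "('a, 'p, 't) rpn \<Rightarrow> 'p \<Rightarrow> 't \<Rightarrow> 'a label" where
  "in_arc N x t = arcs N (Inl (x, t))"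

definition out_arc :: "('a, 'p, 't) rpn \<Rightarrow> 't \<Rightarrow> 'p \<Rightarrow> 'a label" where
  "out_arc N t x = arcs N (Inr (t, x))"

definition items :: "('a, 'p, 't) rpn \<Rightarrow> 'a item set" where
  "items N = Tok ` tokens N \<union> Bond ` bonds N"

definition pos_part :: "'a label \<Rightarrow> 'a item set" where
  "pos_part l = {i. Pos i \<in> l}"

definition neg_part :: "'a label \<Rightarrow> 'a item set" where
  "neg_part l = {i. Neg i \<in> l}"

definition in_places :: "('a, 'p, 't) rpn \<Rightarrow> 't \<Rightarrow> 'p set" where
  "in_places N t = {x \<in> places N. in_arc N x t \<noteq> {}}"

definition out_places :: "('a, 'p, 't) rpn \<Rightarrow> 't \<Rightarrow> 'p set" where
  "out_places N t = {x \<in> places N. out_arc N t x \<noteq> {}}"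

text \<open>Only the positive part of incoming labels is collected in \<open>pre_items\<close>; since outgoing labels
  are positive, this does not affect the difference \<open>effect\<close>.\<close>

definition pre_items :: "('a, 'p, 't) rpn \<Rightarrow> 't \<Rightarrow> 'a item set" where
  "pre_items N t = (\<Union>x\<in>places N. pos_part (in_arc N x t))"

definition post_items :: "('a, 'p, 't) rpn \<Rightarrow> 't \<Rightarrow> 'a item set" where
  "post_items N t = (\<Union>x\<in>places N. pos_part (out_arc N t x))"

definition effect :: "('a, 'p, 't) rpn \<Rightarrow> 't \<Rightarrow> 'a item set" where
  "effect N t = post_items N t - pre_items N t"

text \<open>A set of items in which every bond comes together with the two tokens it connects. Positive
  parts of arc labels and the contents of places are of this form.\<close>

definition bond_closed :: "'a item set \<Rightarrow> bool" where
  "bond_closed C \<longleftrightarrow> (\<forall>b. Bond b \<in> C \<longrightarrow> Tok ` set_uprod b \<subseteq> C)"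

text \<open>As \<open>arcs\<close> is a total function, labels off the domain of F are fixed to be empty.\<close>

definition is_rpn :: "('a, 'p, 't) rpn \<Rightarrow> bool" where
  "is_rpn N \<longleftrightarrow>
     finite (tokens N) \<and> finite (places N) \<and> finite (transitions N) \<and>
     (\<forall>b \<in> bonds N. set_uprod b \<subseteq> tokens N) \<and>
     (\<forall>x t. in_arc N x t \<subseteq> Pos ` items N \<union> Neg ` items N \<and> bond_closed (pos_part (in_arc N x t))) \<and>
     (\<forall>t x. out_arc N t x \<subseteq> Pos ` items N \<and> bond_closed (pos_part (out_arc N t x))) \<and>
     (\<forall>x t. \<not> (x \<in> places N \<and> t \<in> transitions N) \<longrightarrow> in_arc N x t = {} \<and> out_arc N t x = {})"

definition well_formed :: "('a, 'p, 't) rpn \<Rightarrow> bool" where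
  "well_formed N \<longleftrightarrow> (\<forall>t \<in> transitions N.
     (\<forall>a. Tok a \<in> pre_items N t \<longleftrightarrow> Tok a \<in> post_items N t) \<and>
     (\<forall>b. Bond b \<in> pre_items N t \<longrightarrow> Bond b \<in> post_items N t) \<and>
     (\<forall>x \<in> places N. \<forall>y \<in> places N. x \<noteq> y \<longrightarrow> out_arc N t x \<inter> out_arc N t y = {}))"


section \<open>States\<close>

type_synonym ('a, 'p) marking = "'p \<Rightarrow> 'a item set"
type_synonym 't occurrence = "'t \<times> nat"

record ('a, 'p, 't) state =
  marking :: "('a, 'p) marking"
  history :: "'t \<Rightarrow> nat set"
  dependence :: "('t occurrence) rel"

definition initial_marking :: "('a, 'p, 't) rpn \<Rightarrow> ('a, 'p) marking \<Rightarrow> bool" where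
  "initial_marking N M \<longleftrightarrow>
     (\<forall>x. M x \<subseteq> items N \<and> bond_closed (M x)) \<and>
     (\<forall>x. x \<notin> places N \<longrightarrow> M x = {}) \<and>
     (\<forall>a \<in> tokens N. \<exists>!x. x \<in> places N \<and> Tok a \<in> M x)"

definition initial_state :: "('a, 'p) marking \<Rightarrow> ('a, 'p, 't) state" where
  "initial_state M = \<lparr>marking = M, history = (\<lambda>_. {}), dependence = {}\<rparr>"

definition keys :: "('a, 'p, 't) rpn \<Rightarrow> ('a, 'p, 't) state \<Rightarrow> nat set" where
  "keys N s = (\<Union>t\<in>transitions N. history s t)"

definition next_key :: "('a, 'p, 't) rpn \<Rightarrow> ('a, 'p, 't) state \<Rightarrow> nat" where
  "next_key N s = 1 + Max (insert 0 (keys N s))"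

definition last_key :: "('a, 'p, 't) state \<Rightarrow> 't \<Rightarrow> nat" where
  "last_key s t = Max (history s t)"

inductive bond_path :: "'a item set \<Rightarrow> 'a \<Rightarrow> 'a uprod list \<Rightarrow> bool" for C where
  Nil: "bond_path C a []"
| Cons: "bond_path C a (Upair a b # w)"
    if "Bond (Upair a b) \<in> C" and "Tok b \<in> C" and "bond_path C b w"

definition con :: "'a \<Rightarrow> 'a item set \<Rightarrow> 'a item set" where
  "con a C = ({Tok a} \<inter> C) \<union>
     (\<Union>w\<in>{w. bond_path C a w}. \<Union>b\<in>set w. insert (Bond b) (Tok ` set_uprod b))"


section \<open>Execution\<close>

text \<open>The conditions say: all required items are present and no forbidden one is; tokens sent to
  different places are not connected, so that no component has to be split; and a bond on an
  outgoing arc that already exists in an incoming place must be required by the transition, so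
  that the bonds in \<open>effect\<close> are really created by the firing.\<close>

definition forward_enabled :: "('a, 'p, 't) rpn \<Rightarrow> ('a, 'p, 't) state \<Rightarrow> 't \<Rightarrow> bool" where
  "forward_enabled N s t \<longleftrightarrow>
     (\<forall>x \<in> in_places N t. pos_part (in_arc N x t) \<subseteq> marking s x \<and>
                        neg_part (in_arc N x t) \<inter> marking s x = {}) \<and>
     (\<forall>y1 y2 a b. y1 \<noteq> y2 \<and> Pos (Tok a) \<in> out_arc N t y1 \<and> Pos (Tok b) \<in> out_arc N t y2 \<longrightarrow>
        (\<forall>x \<in> in_places N t. Tok b \<notin> con a (marking s x))) \<and>
     (\<forall>x \<in> out_places N t. \<forall>y \<in> in_places N t. \<forall>b.
        Pos (Bond b) \<in> out_arc N t x \<and> Bond b \<in> marking s y \<longrightarrow> Pos (Bond b) \<in> in_arc N y t)"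

definition fire_marking :: "('a, 'p, 't) rpn \<Rightarrow> ('a, 'p) marking \<Rightarrow> 't \<Rightarrow> ('a, 'p) marking" where
  "fire_marking N M t = (\<lambda>x.
     (M x - (\<Union>a\<in>{a. Pos (Tok a) \<in> in_arc N x t}. con a (M x)))
     \<union> pos_part (out_arc N t x)
     \<union> (\<Union>a\<in>{a. Pos (Tok a) \<in> out_arc N t x}. \<Union>y\<in>in_places N t. con a (M y)))"

definition causes :: "('a, 'p, 't) rpn \<Rightarrow> ('a, 'p, 't) state \<Rightarrow> 't \<Rightarrow> ('t occurrence) set" where
  "causes N s t = {(t', k'). t' \<in> transitions N \<and> k' \<in> history s t' \<and> k' < next_key N s \<and>
     (\<exists>x \<in> in_places N t. \<exists>a. Pos (Tok a) \<in> in_arc N x t \<and>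
        con a (marking s x) \<inter> post_items N t' \<noteq> {})}"

definition fire :: "('a, 'p, 't) rpn \<Rightarrow> ('a, 'p, 't) state \<Rightarrow> 't \<Rightarrow> ('a, 'p, 't) state" where
  "fire N s t =
     \<lparr>marking = fire_marking N (marking s) t,
      history = (history s)(t := insert (next_key N s) (history s t)),
      dependence = dependence s \<union> causes N s t \<times> {(t, next_key N s)}\<rparr>"

definition co_enabled :: "('a, 'p, 't) rpn \<Rightarrow> ('a, 'p, 't) state \<Rightarrow> 't \<Rightarrow> bool" where
  "co_enabled N s t \<longleftrightarrow>
     history s t \<noteq> {} \<and>
     (\<forall>x \<in> out_places N t. pos_part (out_arc N t x) \<subseteq> marking s x) \<and>
     (\<forall>occ. ((t, last_key s t), occ) \<notin> dependence s)"

definition reverse_marking :: "('a, 'p, 't) rpn \<Rightarrow> ('a, 'p) marking \<Rightarrow> 't \<Rightarrow> ('a, 'p) marking" where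
  "reverse_marking N M t = (\<lambda>x.
     (M x - (\<Union>a\<in>{a. Pos (Tok a) \<in> out_arc N t x}. con a (M x)))
     \<union> (\<Union>a\<in>{a. Pos (Tok a) \<in> in_arc N x t}. \<Union>y\<in>out_places N t. con a (M y - effect N t)))"

definition reverse :: "('a, 'p, 't) rpn \<Rightarrow> ('a, 'p, 't) state \<Rightarrow> 't \<Rightarrow> ('a, 'p, 't) state" where
  "reverse N s t =
     \<lparr>marking = reverse_marking N (marking s) t,
      history = (history s)(t := history s t - {last_key s t}),
      dependence = {(o1, o2) \<in> dependence s. o1 \<noteq> (t, last_key s t) \<and> o2 \<noteq> (t, last_key s t)}\<rparr>"

datatype 't action = Fwd 't | Rev 't

fun undo :: "'t action \<Rightarrow> 't action" where
  "undo (Fwd t) = Rev t"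
| "undo (Rev t) = Fwd t"

fun step :: "('a, 'p, 't) rpn \<Rightarrow> ('a, 'p, 't) state \<Rightarrow> 't action \<Rightarrow> ('a, 'p, 't) state \<Rightarrow> bool" where
  "step N s (Fwd t) s' \<longleftrightarrow> t \<in> transitions N \<and> forward_enabled N s t \<and> s' = fire N s t"
| "step N s (Rev t) s' \<longleftrightarrow> t \<in> transitions N \<and> co_enabled N s t \<and> s' = reverse N s t"

fun exec :: "('a, 'p, 't) rpn \<Rightarrow> ('a, 'p, 't) state \<Rightarrow> 't action list \<Rightarrow> ('a, 'p, 't) state \<Rightarrow> bool" where
  "exec N s [] s' \<longleftrightarrow> s' = s"
| "exec N s (\<alpha> # \<sigma>) s' \<longleftrightarrow> (\<exists>s''. step N s \<alpha> s'' \<and> exec N s'' \<sigma> s')"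

definition reachable :: "('a, 'p, 't) rpn \<Rightarrow> ('a, 'p) marking \<Rightarrow> ('a, 'p, 't) state \<Rightarrow> bool" where
  "reachable N M0 s \<longleftrightarrow> (\<exists>\<sigma>. exec N (initial_state M0) \<sigma> s)"


section \<open>Causal equivalence\<close>

definition causal_paths :: "('a, 'p, 't) rpn \<Rightarrow> ('a, 'p, 't) state \<Rightarrow> ('t occurrence list) set" where
  "causal_paths N s =
     {\<pi>. (\<forall>(t, k) \<in> set \<pi>. t \<in> transitions N \<and> k \<in> history s t) \<and>
         successively (\<lambda>o1 o2. (o1, o2) \<in> dependence s) \<pi>}"

text \<open>Keys are pairwise distinct in reachable states, so that equality of the causal paths up to
  keys is equality up to an injective renaming of keys. One-element paths make sure that the
  renaming maps the occurrences of each transition onto those of the same transition.\<close>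

definition history_equiv :: "('a, 'p, 't) rpn \<Rightarrow> ('a, 'p, 't) state \<Rightarrow> ('a, 'p, 't) state \<Rightarrow> bool" where
  "history_equiv N s s' \<longleftrightarrow>
     (\<exists>f. inj_on f (keys N s) \<and> map (map_prod id f) ` causal_paths N s = causal_paths N s')"

definition state_equiv :: "('a, 'p, 't) rpn \<Rightarrow> ('a, 'p, 't) state \<Rightarrow> ('a, 'p, 't) state \<Rightarrow> bool" where
  "state_equiv N s s' \<longleftrightarrow> marking s = marking s' \<and> history_equiv N s s'"

definition concurrent :: "('a, 'p, 't) rpn \<Rightarrow> ('a, 'p, 't) state \<Rightarrow> 't action \<Rightarrow> 't action \<Rightarrow> bool" where
  "concurrent N s \<alpha> \<beta> \<longleftrightarrow>
     (\<exists>s1 s2 s1' s2'. step N s \<alpha> s1 \<and> step N s1 \<beta> s1' \<and>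
                       step N s \<beta> s2 \<and> step N s2 \<alpha> s2' \<and> state_equiv N s1' s2')"

text \<open>Traces are sequences of actions, related relative to the state \<open>s\<close> in which they start
  because concurrency depends on the state. The law \<open>cancel\<close> carries no executability condition:
  with negative arc labels it can happen that t is reversed in a state in which it could not be
  executed again, so the sequences related on the way from one execution to another need not all be
  executable.\<close>

inductive trace_equiv ::
    "('a, 'p, 't) rpn \<Rightarrow> ('a, 'p, 't) state \<Rightarrow> 't action list \<Rightarrow> 't action list \<Rightarrow> bool" for N where
  refl: "trace_equiv N s \<sigma> \<sigma>"
| sym: "trace_equiv N s \<sigma> \<tau> \<Longrightarrow> trace_equiv N s \<tau> \<sigma>"
| trans: "trace_equiv N s \<sigma> \<tau> \<Longrightarrow> trace_equiv N s \<tau> \<rho> \<Longrightarrow> trace_equiv N s \<sigma> \<rho>"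
| swap: "concurrent N s \<alpha> \<beta> \<Longrightarrow> trace_equiv N s [\<alpha>, \<beta>] [\<beta>, \<alpha>]"
| cancel: "trace_equiv N s [\<alpha>, undo \<alpha>] []"
| comp_left: "exec N s \<rho> s' \<Longrightarrow> trace_equiv N s' \<sigma> \<tau> \<Longrightarrow> trace_equiv N s (\<rho> @ \<sigma>) (\<rho> @ \<tau>)"
| comp_right: "trace_equiv N s \<sigma> \<tau> \<Longrightarrow> trace_equiv N s (\<sigma> @ \<rho>) (\<tau> @ \<rho>)"

end

theory Submission
  imports Defs
begin

text \<open>A well-formed marking is determined by its set of bonds and the location of every token, a
  transition acts on the components of its tokens only, and the reversal of a firing restores both
  data exactly. Dropping the conditions on absent items (which causal-order reversal can violate),
  every reachable state arises from the initial one by weak firings with increasing keys: an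
  occurrence on which nothing depends commutes with all later ones, so reversing it just deletes it
  from the sequence. In particular such reversals are always possible, commute with each other and
  are inverted by a weak firing.

  If \<open>\<sigma>1\<close> and \<open>\<sigma>2\<close> lead to equivalent states, then a word \<open>\<rho>\<close> that reverses everything in the
  first final state also does so in the second. By the diamond property of reversals, extending
  either execution by \<open>\<rho>\<close> gives a trace equivalent to reversing everything in the common start
  state, and \<open>\<rho>\<close> cancels against its formal inverse.

  Conversely, let a word act on pairs of a state and a pending reduced word: an action is performed
  if it is weakly possible and nothing is pending, and is cancelled with or added to the pending word
  otherwise. As an action and its inverse are mutually inverse up to equivalence of states, the
  result is invariant under trace equivalence, even though the words in between need not be
  executable; on executions it is the final state.\<close>

section \<open>Connected components\<close>

text \<open>Connectivity in the graph with edge set \<open>B\<close>. The closure is reflexive on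
  the whole type and does not mention places; \<open>Tok_con\<close> and \<open>Bond_con\<close>
  relate it to \<open>con\<close>.\<close>

definition conn :: "'a uprod set \<Rightarrow> 'a rel" where
  "conn B = {(a, b). Upair a b \<in> B}\<^sup>*"

lemma conn_refl [simp]: "(a, a) \<in> conn B"
  by (simp add: conn_def)

lemma Upair_commute: "Upair a b = Upair b a"
  by simp

lemma conn_bond: "b \<in> B \<Longrightarrow> a \<in> set_uprod b \<Longrightarrow> c \<in> set_uprod b \<Longrightarrow> (a, c) \<in> conn B"
proof (cases "a = c")
  case False
  assume "b \<in> B" "a \<in> set_uprod b" "c \<in> set_uprod b"
  with False have "Upair a c \<in> B" by (cases b) (auto simp: Upair_commute[of c a])
  then show ?thesis by (auto simp: conn_def)
qed simp

lemma conn_trans: "(a, b) \<in> conn B \<Longrightarrow> (b, c) \<in> conn B \<Longrightarrow> (a, c) \<in> conn B"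
  unfolding conn_def by (rule rtrancl_trans)

lemma conn_sym: "(a, b) \<in> conn B \<Longrightarrow> (b, a) \<in> conn B"
proof -
  have "sym {(a, b). Upair a b \<in> B}"
    by (simp add: sym_def Upair_commute)
  then show "(a, b) \<in> conn B \<Longrightarrow> (b, a) \<in> conn B"
    unfolding conn_def by (meson sym_rtrancl symE)
qed

lemma conn_mono: "B \<subseteq> B' \<Longrightarrow> conn B \<subseteq> conn B'"
  unfolding conn_def by (rule rtrancl_mono) auto

text \<open>In the step case the bond is given together with two of its ends, so that uses need not
  fix an orientation.\<close>

lemma conn_induct [consumes 1, case_names refl step]:
  assumes "(a, c) \<in> conn B"
    and "P a" and "\<And>y z b. P y \<Longrightarrow> (a, y) \<in> conn B \<Longrightarrow> b \<in> B \<Longrightarrow> y \<in> set_uprod b \<Longrightarrow> z \<in> set_uprod b \<Longrightarrow> P z"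
  shows "P c"
  using assms(1) unfolding conn_def
proof (induction rule: rtrancl_induct)
  case base
  then show ?case by (rule assms(2))
next
  case (step y z)
  then show ?case using assms(3)[of y "Upair y z" z] by (auto simp: conn_def)
qed

text \<open>A path can be cut after its last new bond: it is then in \<open>S\<close>, and only old
  bonds follow. With \<open>S\<close> the tokens of a transition and \<open>B'\<close> the bonds it
  makes, the set of tokens it moves is the same with and without these bonds.\<close>

lemma conn_extend:
  assumes "\<forall>b \<in> B'. set_uprod b \<subseteq> S"
  shows "(\<exists>a\<in>S. (a, c) \<in> conn (B \<union> B')) \<longleftrightarrow> (\<exists>a\<in>S. (a, c) \<in> conn B)"
proof
  assume "\<exists>a\<in>S. (a, c) \<in> conn (B \<union> B')"
  then obtain a where a: "a \<in> S" "(a, c) \<in> conn (B \<union> B')" by blast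
  from a(2) show "\<exists>a\<in>S. (a, c) \<in> conn B"
  proof (induction rule: conn_induct)
    case refl
    then show ?case using a(1) by (meson conn_refl)
  next
    case (step y z b)
    show ?case
    proof (cases "b \<in> B")
      case True
      then have "(y, z) \<in> conn B" using step(4,5) conn_bond by metis
      then show ?thesis using step(1) conn_trans by metis
    next
      case False
      then have "z \<in> S" using step(3,5) assms by blast
      then show ?thesis using conn_refl by metis
    qed
  qed
qed (use conn_mono[of B "B \<union> B'"] in auto)

text \<open>The first new bond on a path from \<open>a\<close> would have to be entered through an
  element of \<open>S\<close>, and none is reachable by old bonds.\<close>

lemma conn_avoid:
  assumes "\<forall>b \<in> B'. set_uprod b \<subseteq> S" and "\<forall>s\<in>S. (a, s) \<notin> conn B"
  shows "(a, c) \<in> conn (B \<union> B') \<longleftrightarrow> (a, c) \<in> conn B"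
proof
  assume "(a, c) \<in> conn (B \<union> B')"
  then show "(a, c) \<in> conn B"
  proof (induction rule: conn_induct)
    case (step y z b)
    have "y \<notin> S" using step(1) assms(2) by blast
    then have "b \<in> B" using step(3,4) assms(1) by blast
    then have "(y, z) \<in> conn B" using step(4,5) conn_bond by metis
    then show ?case using step(1) conn_trans by metis
  qed simp
qed (use conn_mono[of B "B \<union> B'"] in auto)

section \<open>Markings given by bonds and token locations\<close>

text \<open>A bond has no location of its own but lies where all its ends lie; if these were apart,
  it would be in no place, which \<open>located\<close> excludes.\<close>

definition assemble :: "('a, 'p, 't) rpn \<Rightarrow> 'a uprod set \<Rightarrow> ('a \<Rightarrow> 'p) \<Rightarrow> ('a, 'p) marking" where
  "assemble N B l x = {Tok a | a. a \<in> tokens N \<and> l a = x} \<union> {Bond b | b. b \<in> B \<and> (\<forall>a \<in> set_uprod b. l a = x)}"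

definition located :: "('a, 'p, 't) rpn \<Rightarrow> 'a uprod set \<Rightarrow> ('a \<Rightarrow> 'p) \<Rightarrow> bool" where
  "located N B l \<longleftrightarrow> B \<subseteq> bonds N \<and> (\<forall>b \<in> B. \<forall>a \<in> set_uprod b. \<forall>c \<in> set_uprod b. l a = l c)"

lemma assemble_Tok [simp]: "Tok a \<in> assemble N B l x \<longleftrightarrow> a \<in> tokens N \<and> l a = x"
  by (auto simp: assemble_def)

lemma assemble_Bond [simp]: "Bond b \<in> assemble N B l x \<longleftrightarrow> b \<in> B \<and> (\<forall>a \<in> set_uprod b. l a = x)"
  by (auto simp: assemble_def)

lemma uprod_nonempty: "\<exists>a. a \<in> set_uprod b"
  by (cases b) auto

text \<open>Read off the outgoing arcs; in a well-formed net the incoming arcs carry the same tokens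
  (\<open>used_iff_in\<close>).\<close>

definition used :: "('a, 'p, 't) rpn \<Rightarrow> 't \<Rightarrow> 'a set" where
  "used N t = {a. \<exists>x. Pos (Tok a) \<in> out_arc N t x}"

definition made :: "('a, 'p, 't) rpn \<Rightarrow> 't \<Rightarrow> 'a uprod set" where
  "made N t = {b. \<exists>x. Pos (Bond b) \<in> out_arc N t x}"

definition needed :: "('a, 'p, 't) rpn \<Rightarrow> 't \<Rightarrow> 'a uprod set" where
  "needed N t = {b. \<exists>x. Pos (Bond b) \<in> in_arc N x t}"

text \<open>Forward enabledness without the conditions on absent items.\<close>

definition weakly_enabled :: "('a, 'p, 't) rpn \<Rightarrow> ('a, 'p) marking \<Rightarrow> 't \<Rightarrow> bool" where
  "weakly_enabled N M t \<longleftrightarrow>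
     (\<forall>x \<in> in_places N t. pos_part (in_arc N x t) \<subseteq> M x) \<and>
     (\<forall>y1 y2 a b. y1 \<noteq> y2 \<and> Pos (Tok a) \<in> out_arc N t y1 \<and> Pos (Tok b) \<in> out_arc N t y2 \<longrightarrow>
        (\<forall>x \<in> in_places N t. Tok b \<notin> con a (M x))) \<and>
     (\<forall>x \<in> out_places N t. \<forall>y \<in> in_places N t. \<forall>b.
        Pos (Bond b) \<in> out_arc N t x \<and> Bond b \<in> M y \<longrightarrow> Pos (Bond b) \<in> in_arc N y t)"

text \<open>\<open>weakly_enabled\<close> and the relocation of tokens by a firing, in terms of the bonds \<open>B\<close> and the
  locations \<open>l\<close>.\<close>

definition fires_at :: "('a, 'p, 't) rpn \<Rightarrow> 'a uprod set \<Rightarrow> ('a \<Rightarrow> 'p) \<Rightarrow> 't \<Rightarrow> bool" where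
  "fires_at N B l t \<longleftrightarrow>
     (\<forall>x a. Pos (Tok a) \<in> in_arc N x t \<longrightarrow> l a = x) \<and> needed N t \<subseteq> B \<and>
     (\<forall>y1 y2 a b. Pos (Tok a) \<in> out_arc N t y1 \<and> Pos (Tok b) \<in> out_arc N t y2 \<and> (a, b) \<in> conn B \<longrightarrow> y1 = y2) \<and>
     made N t \<inter> B \<subseteq> needed N t"

definition fired_loc :: "('a, 'p, 't) rpn \<Rightarrow> 't \<Rightarrow> 'a uprod set \<Rightarrow> ('a \<Rightarrow> 'p) \<Rightarrow> 'a \<Rightarrow> 'p" where
  "fired_loc N t B l c = (if \<exists>a \<in> used N t. (a, c) \<in> conn B
     then SOME y. \<exists>a. Pos (Tok a) \<in> out_arc N t y \<and> (a, c) \<in> conn B else l c)"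

locale reversing_net =
  fixes N :: "('a, 'p, 't) rpn"
  assumes rpn: "is_rpn N" and wf: "well_formed N"
begin

section \<open>Arc labels of a well-formed net\<close>

lemma bond_tokens: "b \<in> bonds N \<Longrightarrow> a \<in> set_uprod b \<Longrightarrow> a \<in> tokens N"
  using rpn by (auto simp: is_rpn_def)

lemma in_arc_item: "Pos i \<in> in_arc N x t \<Longrightarrow> i \<in> items N"
  using rpn unfolding is_rpn_def by blast

lemma out_arc_item: "Pos i \<in> out_arc N t x \<Longrightarrow> i \<in> items N"
  using rpn unfolding is_rpn_def by blast

lemma in_arc_places: "i \<in> in_arc N x t \<Longrightarrow> x \<in> in_places N t \<and> x \<in> places N \<and> t \<in> transitions N"
  using rpn unfolding is_rpn_def in_places_def by blast

lemma out_arc_places: "i \<in> out_arc N t x \<Longrightarrow> x \<in> out_places N t \<and> x \<in> places N \<and> t \<in> transitions N"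
  using rpn unfolding is_rpn_def out_places_def by blast

lemma Tok_items [simp]: "Tok a \<in> items N \<longleftrightarrow> a \<in> tokens N"
  and Bond_items [simp]: "Bond b \<in> items N \<longleftrightarrow> b \<in> bonds N"
  by (auto simp: items_def)

lemma in_arc_closed:
  assumes "Pos (Bond b) \<in> in_arc N x t" and "a \<in> set_uprod b"
  shows "Pos (Tok a) \<in> in_arc N x t"
proof -
  have "bond_closed (pos_part (in_arc N x t))" using rpn by (simp add: is_rpn_def)
  then have "Tok ` set_uprod b \<subseteq> pos_part (in_arc N x t)"
    using assms(1) by (simp add: bond_closed_def pos_part_def)
  then show ?thesis using assms(2) by (auto simp: pos_part_def)
qed

lemma out_arc_closed:
  assumes "Pos (Bond b) \<in> out_arc N t x" and "a \<in> set_uprod b"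
  shows "Pos (Tok a) \<in> out_arc N t x"
proof -
  have "bond_closed (pos_part (out_arc N t x))" using rpn by (simp add: is_rpn_def)
  then have "Tok ` set_uprod b \<subseteq> pos_part (out_arc N t x)"
    using assms(1) by (simp add: bond_closed_def pos_part_def)
  then show ?thesis using assms(2) by (auto simp: pos_part_def)
qed

lemma post_items_eq: "post_items N t = Tok ` used N t \<union> Bond ` made N t"
proof -
  have "i \<in> post_items N t \<longleftrightarrow> i \<in> Tok ` used N t \<union> Bond ` made N t" for i
    using out_arc_places by (cases i) (force simp: post_items_def pos_part_def used_def made_def)+
  then show ?thesis by blast
qed

lemma used_iff_in: "a \<in> used N t \<longleftrightarrow> (\<exists>x. Pos (Tok a) \<in> in_arc N x t)"
proof (cases "t \<in> transitions N")
  case True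
  then have "Tok a \<in> pre_items N t \<longleftrightarrow> Tok a \<in> post_items N t"
    using wf by (auto simp: well_formed_def)
  then have "Tok a \<in> pre_items N t \<longleftrightarrow> a \<in> used N t"
    by (auto simp: post_items_eq)
  then show ?thesis using in_arc_places by (force simp: pre_items_def pos_part_def)
next
  case False
  then show ?thesis using in_arc_places out_arc_places by (auto simp: used_def)
qed

lemma pre_items_eq: "pre_items N t = Tok ` used N t \<union> Bond ` needed N t"
proof -
  have "i \<in> pre_items N t \<longleftrightarrow> i \<in> Tok ` used N t \<union> Bond ` needed N t" for i
    using in_arc_places by (cases i) (force simp: pre_items_def pos_part_def used_iff_in needed_def)+
  then show ?thesis by blast
qed

lemma needed_made: "needed N t \<subseteq> made N t"
proof
  fix b assume b: "b \<in> needed N t"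
  then have "t \<in> transitions N" using in_arc_places by (auto simp: needed_def)
  moreover have "Bond b \<in> pre_items N t" using b by (auto simp: pre_items_eq)
  ultimately have "Bond b \<in> post_items N t" using wf by (auto simp: well_formed_def)
  then show "b \<in> made N t" by (auto simp: post_items_eq)
qed

lemma effect_eq: "effect N t = Bond ` (made N t - needed N t)"
  by (auto simp: effect_def post_items_eq pre_items_eq)

lemma made_used: "b \<in> made N t \<Longrightarrow> set_uprod b \<subseteq> used N t"
  unfolding made_def used_def using out_arc_closed by blast

lemma made_bonds: "made N t \<subseteq> bonds N"
  unfolding made_def using out_arc_item Bond_items by blast

lemma used_tokens: "used N t \<subseteq> tokens N"
  unfolding used_def using out_arc_item Tok_items by blast

section \<open>Connected components of assembled markings\<close>

lemma located_bond: "located N B l \<Longrightarrow> b \<in> B \<Longrightarrow> a \<in> set_uprod b \<Longrightarrow> c \<in> set_uprod b \<Longrightarrow> l c = l a"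
  unfolding located_def by blast

lemma located_conn:
  assumes "located N B l" and "(a, c) \<in> conn B"
  shows "l c = l a"
  using assms(2)
proof (induction rule: conn_induct)
  case (step y z b)
  then show ?case using located_bond[OF assms(1) step(3,4,5)] by simp
qed simp

lemma located_conn_tokens:
  assumes "located N B l" and "(a, c) \<in> conn B" and "a \<in> tokens N"
  shows "c \<in> tokens N"
  using assms(2)
proof (induction rule: conn_induct)
  case (step y z b)
  then have "b \<in> bonds N" using assms(1) by (auto simp: located_def)
  then show ?case using step(5) by (rule bond_tokens)
qed (rule assms(3))

text \<open>A path inside the contents of \<open>x\<close> crosses only edges of the graph, so it
  explores only the component of \<open>a\<close>. The empty path starts at any token whatsoever, so
  the claims about \<open>a\<close> need a bond on the path.\<close>

lemma bond_path_assemble: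
  assumes "bond_path (assemble N B l x) a w" and "located N B l" and "b \<in> set w"
  shows "a \<in> tokens N \<and> l a = x \<and> b \<in> B \<and> (\<forall>c\<in>set_uprod b. (a, c) \<in> conn B)"
  using assms
proof (induction arbitrary: b rule: bond_path.induct)
  case (Cons a d w)
  have ad: "Upair a d \<in> B" "l a = x"
    using Cons.hyps(1) by simp_all
  have "a \<in> tokens N"
    by (rule bond_tokens[of "Upair a d"]) (use ad Cons.prems(1) in \<open>auto simp: located_def\<close>)
  moreover have ac: "(a, c) \<in> conn B" if "c \<in> set_uprod (Upair a d)" for c
    using conn_bond[OF ad(1) _ that] by simp
  moreover have "b \<in> B \<and> (\<forall>c\<in>set_uprod b. (d, c) \<in> conn B)" if "b \<in> set w"
    using Cons.IH[OF Cons.prems(1) that] by simp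
  moreover have "(a, d) \<in> conn B" using ac by simp
  ultimately show ?case
    using ad Cons.prems(2) by (auto intro: conn_trans[OF \<open>(a, d) \<in> conn B\<close>])
qed simp

text \<open>All tokens connected with \<open>a\<close> share its location, so a chain of bonds from
  \<open>a\<close> to \<open>c\<close> stays inside the contents of \<open>x\<close> and can be
  prepended to \<open>w\<close>. A \<open>bond_path\<close> may revisit tokens, so concatenation is
  unrestricted.\<close>

lemma bond_path_conn:
  assumes "(a, c) \<in> conn B" and "located N B l" and "a \<in> tokens N" and "l a = x"
    and "bond_path (assemble N B l x) c w"
  shows "\<exists>w'. bond_path (assemble N B l x) a w' \<and> set w \<subseteq> set w'"
  using assms(1,3,4) unfolding conn_def
proof (induction rule: converse_rtrancl_induct)
  case base
  then show ?case using assms(5) by blast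
next
  case (step a d)
  then have ad: "Upair a d \<in> B" by simp
  then have "l d = x" using located_bond[OF assms(2) ad, of a d] step.prems(2) by simp
  moreover have "d \<in> tokens N"
    by (rule bond_tokens[of "Upair a d"]) (use ad assms(2) in \<open>auto simp: located_def\<close>)
  ultimately obtain w' where w': "bond_path (assemble N B l x) d w'" "set w \<subseteq> set w'"
    using step.IH by blast
  have "bond_path (assemble N B l x) a (Upair a d # w')"
    using ad w'(1) step.prems \<open>l d = x\<close> \<open>d \<in> tokens N\<close> by (intro bond_path.Cons) simp_all
  then show ?case using w'(2) by (meson set_subset_Cons subset_trans)
qed

lemma Bond_con:
  assumes "located N B l"
  shows "Bond b \<in> con a (assemble N B l x) \<longleftrightarrow>
    a \<in> tokens N \<and> l a = x \<and> b \<in> B \<and> (\<exists>c\<in>set_uprod b. (a, c) \<in> conn B)"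
proof
  assume "Bond b \<in> con a (assemble N B l x)"
  then obtain w where "bond_path (assemble N B l x) a w" "b \<in> set w"
    by (auto simp: con_def)
  then show "a \<in> tokens N \<and> l a = x \<and> b \<in> B \<and> (\<exists>c\<in>set_uprod b. (a, c) \<in> conn B)"
    using bond_path_assemble[OF _ assms, of x a w b] uprod_nonempty[of b] by blast
next
  assume R: "a \<in> tokens N \<and> l a = x \<and> b \<in> B \<and> (\<exists>c\<in>set_uprod b. (a, c) \<in> conn B)"
  then obtain c where c: "c \<in> set_uprod b" "(a, c) \<in> conn B" by blast
  then obtain d where d: "b = Upair c d" by (cases b) auto
  have b: "b \<in> B" "b \<in> bonds N" using R assms by (auto simp: located_def)
  have "l c = x" using R located_conn[OF assms c(2)] by simp
  moreover from this have "l d = x" using located_bond[OF assms b(1) c(1), of d] d by simp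
  moreover have "d \<in> tokens N" by (rule bond_tokens[OF b(2)]) (simp add: d)
  \<comment> \<open>\<open>con\<close> collects bonds that are traversed, so the path from
    \<open>a\<close> to \<open>c\<close> is extended by crossing \<open>b\<close> itself.\<close>
  ultimately have "bond_path (assemble N B l x) c [b]"
    unfolding d using b d by (intro bond_path.intros) simp_all
  with bond_path_conn[OF c(2) assms] R obtain w where "bond_path (assemble N B l x) a w" "b \<in> set w"
    by (metis list.set_intros(1) subsetD)
  then show "Bond b \<in> con a (assemble N B l x)" by (auto simp: con_def)
qed

lemma Tok_con:
  assumes "located N B l"
  shows "Tok c \<in> con a (assemble N B l x) \<longleftrightarrow> a \<in> tokens N \<and> l a = x \<and> (a, c) \<in> conn B"
proof
  assume "Tok c \<in> con a (assemble N B l x)"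
  then consider "c = a" "a \<in> tokens N" "l a = x"
    | w b where "bond_path (assemble N B l x) a w" "b \<in> set w" "c \<in> set_uprod b"
    by (auto simp: con_def)
  then show "a \<in> tokens N \<and> l a = x \<and> (a, c) \<in> conn B"
  proof cases
    case 2
    then show ?thesis using bond_path_assemble[OF 2(1) assms 2(2)] by simp
  qed simp
next
  assume R: "a \<in> tokens N \<and> l a = x \<and> (a, c) \<in> conn B"
  show "Tok c \<in> con a (assemble N B l x)"
  proof (cases "c = a")
    case True
    then show ?thesis using R by (auto simp: con_def)
  next
    case False
    \<comment> \<open>\<open>d\<close> is the token before \<open>c\<close> on a connecting chain;
      the last bond carries \<open>c\<close> into the component.\<close>
    then obtain d where d: "(a, d) \<in> conn B" "Upair d c \<in> B"
      using R unfolding conn_def by (auto elim: rtranclE)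
    have "Bond (Upair d c) \<in> con a (assemble N B l x)"
      using Bond_con[OF assms, of "Upair d c"] R d by auto
    then obtain w where "bond_path (assemble N B l x) a w" "Upair d c \<in> set w"
      by (auto simp: con_def)
    moreover have "Tok c \<in> Tok ` set_uprod (Upair d c)" by simp
    ultimately show ?thesis unfolding con_def by blast
  qed
qed

section \<open>Enabledness and firing in terms of bonds and locations\<close>

lemma weakly_enabled_assemble:
  assumes loc: "located N B l" 
  shows "weakly_enabled N (assemble N B l) t \<longleftrightarrow> fires_at N B l t"
proof -
  have 1: "(\<forall>x \<in> in_places N t. pos_part (in_arc N x t) \<subseteq> assemble N B l x) \<longleftrightarrow>
      (\<forall>x a. Pos (Tok a) \<in> in_arc N x t \<longrightarrow> l a = x) \<and> needed N t \<subseteq> B" (is "?L \<longleftrightarrow> ?R")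
  proof
    assume L: ?L
    have *: "i \<in> assemble N B l x" if "Pos i \<in> in_arc N x t" for i x
      using that in_arc_places[OF that] L by (auto simp: pos_part_def)
    have "l a = x" if "Pos (Tok a) \<in> in_arc N x t" for a x
      using *[OF that] by simp
    moreover have "b \<in> B" if "Pos (Bond b) \<in> in_arc N x t" for b x
      using *[OF that] by simp
    ultimately show ?R by (auto simp: needed_def)
  next
    assume R: ?R
    have "i \<in> assemble N B l x" if "Pos i \<in> in_arc N x t" for i x
    proof (cases i)
      case (Bond b)
      then have "b \<in> B" using that R by (auto simp: needed_def)
      moreover have "l a = x" if "a \<in> set_uprod b" for a
        using in_arc_closed[of b x t a] that \<open>Pos i \<in> in_arc N x t\<close> R Bond by simp
      ultimately show ?thesis using Bond by simp
    qed (use that R in_arc_item[OF that] in auto)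
    then show ?L by (auto simp: pos_part_def)
  qed
  \<comment> \<open>This clause and the next are translated under the first one: a token required by
    \<open>t\<close> then lies in an incoming place, so its whole component is visible
    there.\<close>
  have 2: "(\<forall>y1 y2 a b. y1 \<noteq> y2 \<and> Pos (Tok a) \<in> out_arc N t y1 \<and> Pos (Tok b) \<in> out_arc N t y2 \<longrightarrow>
        (\<forall>x \<in> in_places N t. Tok b \<notin> con a (assemble N B l x))) \<longleftrightarrow>
      (\<forall>y1 y2 a b. Pos (Tok a) \<in> out_arc N t y1 \<and> Pos (Tok b) \<in> out_arc N t y2 \<and> (a, b) \<in> conn B \<longrightarrow> y1 = y2)"
    if R: "\<forall>x a. Pos (Tok a) \<in> in_arc N x t \<longrightarrow> l a = x"
  proof -
    have "(\<forall>x \<in> in_places N t. Tok b \<notin> con a (assemble N B l x)) \<longleftrightarrow> (a, b) \<notin> conn B"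
      if "Pos (Tok a) \<in> out_arc N t y" for a b y
    proof -
      have a: "a \<in> used N t" using that by (auto simp: used_def)
      then obtain x where x: "Pos (Tok a) \<in> in_arc N x t" using used_iff_in by blast
      have "x \<in> in_places N t" using in_arc_places[OF x] by simp
      moreover have "l a = x" using R x by simp
      moreover have "a \<in> tokens N" using a used_tokens by blast
      ultimately show ?thesis by (auto simp: Tok_con[OF loc])
    qed
    then show ?thesis by (metis (no_types, lifting))
  qed
  have 3: "(\<forall>x \<in> out_places N t. \<forall>y \<in> in_places N t. \<forall>b.
        Pos (Bond b) \<in> out_arc N t x \<and> Bond b \<in> assemble N B l y \<longrightarrow> Pos (Bond b) \<in> in_arc N y t)
      \<longleftrightarrow> made N t \<inter> B \<subseteq> needed N t" (is "?L \<longleftrightarrow> ?R")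
    if R: "\<forall>x a. Pos (Tok a) \<in> in_arc N x t \<longrightarrow> l a = x"
  proof
    assume L: ?L
    show ?R
    proof
      fix b assume b: "b \<in> made N t \<inter> B"
      then obtain x where x: "Pos (Bond b) \<in> out_arc N t x" by (auto simp: made_def)
      obtain a where a: "a \<in> set_uprod b" using uprod_nonempty[of b] by blast
      \<comment> \<open>An end of a made bond is a token of \<open>t\<close>; it lies in some
        incoming place \<open>y\<close>, and so does the bond, being in \<open>B\<close>.\<close>
      then have "a \<in> used N t" using b made_used[of b t] by blast
      then obtain y where y: "Pos (Tok a) \<in> in_arc N y t" using used_iff_in by blast
      have "l a = y" using R y by blast
      then have "Bond b \<in> assemble N B l y" using located_bond[OF loc _ a] b by simp
      then have "Pos (Bond b) \<in> in_arc N y t"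
        using L x in_arc_places[OF y] out_arc_places[OF x] by blast
      then show "b \<in> needed N t" by (auto simp: needed_def)
    qed
  next
    assume R': ?R
    show ?L
    proof (intro ballI allI impI)
      fix x y b assume "y \<in> in_places N t" and *: "Pos (Bond b) \<in> out_arc N t x \<and> Bond b \<in> assemble N B l y"
      then have "b \<in> needed N t" using R' by (auto simp: made_def)
      then obtain z where z: "Pos (Bond b) \<in> in_arc N z t" by (auto simp: needed_def)
      obtain a where a: "a \<in> set_uprod b" using uprod_nonempty[of b] by blast
      then have "l a = z" using R in_arc_closed[OF z] by simp
      then have "z = y" using * a by auto
      then show "Pos (Bond b) \<in> in_arc N y t" using z by simp
    qed
  qed
  show ?thesis
  \<comment> \<open>If some required token is misplaced, the first clause already fails on both
    sides.\<close>
  proof (cases "\<forall>x a. Pos (Tok a) \<in> in_arc N x t \<longrightarrow> l a = x")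
    case True
    show ?thesis unfolding weakly_enabled_def fires_at_def 1 2[OF True] 3[OF True] by simp
  next
    case False
    show ?thesis unfolding weakly_enabled_def fires_at_def 1 by (simp only: False simp_thms)
  qed
qed

text \<open>Two outgoing tokens connected with \<open>c\<close> are connected with each other, so
  \<open>fires_at\<close> gives them the same target; this makes the choice in
  \<open>fired_loc\<close> unique.\<close>

lemma fired_loc_moved:
  assumes "fires_at N B l t" and "Pos (Tok a) \<in> out_arc N t y" and "(a, c) \<in> conn B"
  shows "fired_loc N t B l c = y"
proof -
  have "(SOME y. \<exists>a. Pos (Tok a) \<in> out_arc N t y \<and> (a, c) \<in> conn B) = y"
  proof (rule some_equality)
    fix y' assume "\<exists>a. Pos (Tok a) \<in> out_arc N t y' \<and> (a, c) \<in> conn B"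
    then obtain a' where a': "Pos (Tok a') \<in> out_arc N t y'" "(a', c) \<in> conn B" by blast
    then have "(a', a) \<in> conn B" using conn_trans[OF a'(2) conn_sym[OF assms(3)]] by simp
    then show "y' = y" using assms(1,2) a'(1) unfolding fires_at_def by blast
  qed (use assms in blast)
  moreover have "a \<in> used N t" using assms by (auto simp: used_def)
  ultimately show ?thesis using assms(3) by (auto simp: fired_loc_def)
qed

lemma fired_loc_unmoved: "\<not> (\<exists>a \<in> used N t. (a, c) \<in> conn B) \<Longrightarrow> fired_loc N t B l c = l c"
  by (simp add: fired_loc_def)

text \<open>An old bond lies in one component, which moves as a whole or not at all. A new bond has
  all its ends on one outgoing arc.\<close>

lemma located_fire:
  assumes "located N B l" and "fires_at N B l t"
  shows "located N (B \<union> made N t) (fired_loc N t B l)"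
proof -
  have "fired_loc N t B l a = fired_loc N t B l c" if "b \<in> B \<union> made N t" "a \<in> set_uprod b" "c \<in> set_uprod b" for b a c
  proof (cases "b \<in> B")
    case True
    then have ac: "(a, c) \<in> conn B" using that conn_bond[of b B a c] by simp
    show ?thesis
    proof (cases "\<exists>d \<in> used N t. (d, a) \<in> conn B")
      case True
      then obtain d y where "Pos (Tok d) \<in> out_arc N t y" "(d, a) \<in> conn B" by (auto simp: used_def)
      moreover from this have "(d, c) \<in> conn B" using ac conn_trans[of d a B c] by simp
      ultimately show ?thesis using fired_loc_moved[OF assms(2), of d y] by simp
    next
      case False
      then have "\<not> (\<exists>d \<in> used N t. (d, c) \<in> conn B)" using conn_trans[OF _ conn_sym[OF ac]] by blast
      then show ?thesis using fired_loc_unmoved[OF False] fired_loc_unmoved located_conn[OF assms(1) ac] by simp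
    qed
  next
    case False
    then have "b \<in> made N t" using that by blast
    then obtain y where "Pos (Bond b) \<in> out_arc N t y" by (auto simp: made_def)
    then have "Pos (Tok a) \<in> out_arc N t y" "Pos (Tok c) \<in> out_arc N t y" using that out_arc_closed by blast+
    then show ?thesis using fired_loc_moved[OF assms(2) _ conn_refl] by simp
  qed
  then show ?thesis using assms(1) made_bonds unfolding located_def by blast
qed

lemma mem_fire: "i \<in> fire_marking N M t x \<longleftrightarrow>
    i \<in> M x \<and> (\<forall>a. Pos (Tok a) \<in> in_arc N x t \<longrightarrow> i \<notin> con a (M x)) \<or> Pos i \<in> out_arc N t x \<or>
    (\<exists>a y. Pos (Tok a) \<in> out_arc N t x \<and> y \<in> in_places N t \<and> i \<in> con a (M y))"
  by (auto simp: fire_marking_def pos_part_def)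

text \<open>A token is moved exactly if its component contains a token of \<open>t\<close>; it then
  leaves the place of the component and joins the target of that token. Bonds follow their ends, and
  new bonds lie where the outgoing arcs put their ends.\<close>

lemma fire_assemble:
  assumes loc: "located N B l" and en: "fires_at N B l t"
  shows "fire_marking N (assemble N B l) t = assemble N (B \<union> made N t) (fired_loc N t B l)"
proof -
  have inl: "l a = x" if "Pos (Tok a) \<in> in_arc N x t" for a x using en that by (auto simp: fires_at_def)
  have inp: "l a \<in> in_places N t \<and> Pos (Tok a) \<in> in_arc N (l a) t" if "a \<in> used N t" for a
    using that used_iff_in[of a t] inl[of a] in_arc_places[of "Pos (Tok a)"] by blast
  have outu: "a \<in> used N t \<and> a \<in> tokens N" if "Pos (Tok a) \<in> out_arc N t x" for a x
    using that used_tokens[of t] unfolding used_def by blast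
  have tok: "Tok c \<in> fire_marking N (assemble N B l) t x \<longleftrightarrow> c \<in> tokens N \<and> fired_loc N t B l c = x" for c x
  proof (cases "\<exists>a \<in> used N t. (a, c) \<in> conn B")
    case True
    then obtain a y where a: "Pos (Tok a) \<in> out_arc N t y" "(a, c) \<in> conn B" by (auto simp: used_def)
    have au: "a \<in> used N t" "a \<in> tokens N" using a outu by blast+
    have f: "fired_loc N t B l c = y" using fired_loc_moved[OF en a] .
    have c: "c \<in> tokens N" using a au located_conn_tokens[OF loc] by blast
    have lc: "l c = l a" using located_conn[OF loc a(2)] .
    show ?thesis
    proof
      assume "Tok c \<in> fire_marking N (assemble N B l) t x"
      then consider "Tok c \<in> assemble N B l x" "\<not> (\<exists>a'. Pos (Tok a') \<in> in_arc N x t \<and> Tok c \<in> con a' (assemble N B l x))"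
        | "Pos (Tok c) \<in> out_arc N t x"
        | a' z where "Pos (Tok a') \<in> out_arc N t x" "Tok c \<in> con a' (assemble N B l z)"
        unfolding mem_fire by blast
      then show "c \<in> tokens N \<and> fired_loc N t B l c = x"
      proof cases
        \<comment> \<open>A moved token does not survive among the leftovers of its old place:
          \<open>a\<close> is on the incoming arc from there, so its component is removed.\<close>
        case 1
        then have "l a = x" using lc by simp
        then have "Pos (Tok a) \<in> in_arc N x t" "Tok c \<in> con a (assemble N B l x)"
          using inp[OF au(1)] Tok_con[OF loc] a(2) au(2) by auto
        then show ?thesis using 1(2) by blast
      next
        case 2
        then show ?thesis using fired_loc_moved[OF en 2 conn_refl] c by simp
      next
        case 3
        then have "(a', c) \<in> conn B" using Tok_con[OF loc] by blast
        then show ?thesis using fired_loc_moved[OF en 3(1)] c by simp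
      qed
    next
      assume "c \<in> tokens N \<and> fired_loc N t B l c = x"
      then have "Pos (Tok a) \<in> out_arc N t x" using a f by simp
      moreover have "Tok c \<in> con a (assemble N B l (l a))" using Tok_con[OF loc] a au by blast
      ultimately show "Tok c \<in> fire_marking N (assemble N B l) t x"
        using inp[OF au(1)] unfolding mem_fire by blast
    qed
  next
    case False
    have no: "Tok c \<notin> con a (assemble N B l z)" if "a \<in> used N t" for a z
      using Tok_con[OF loc, of c a z] that False by blast
    have "Tok c \<notin> con a (assemble N B l z)" if "Pos (Tok a) \<in> out_arc N t x" for a z
      using no outu[OF that] by simp
    moreover have "Tok c \<notin> con a (assemble N B l z)" if "Pos (Tok a) \<in> in_arc N x t" for a z
      using no used_iff_in[of a t] that by blast
    moreover have "Pos (Tok c) \<notin> out_arc N t x"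
      using outu[of c x] False conn_refl[of c B] by blast
    ultimately have "Tok c \<in> fire_marking N (assemble N B l) t x \<longleftrightarrow> Tok c \<in> assemble N B l x"
      unfolding mem_fire by blast
    then show ?thesis using fired_loc_unmoved[OF False] by simp
  qed
  have bond: "Bond b \<in> fire_marking N (assemble N B l) t x \<longleftrightarrow>
      b \<in> B \<union> made N t \<and> (\<forall>c\<in>set_uprod b. fired_loc N t B l c = x)" for b x
  proof
    assume "Bond b \<in> fire_marking N (assemble N B l) t x"
    then consider "Bond b \<in> assemble N B l x" "\<not> (\<exists>a'. Pos (Tok a') \<in> in_arc N x t \<and> Bond b \<in> con a' (assemble N B l x))"
      | "Pos (Bond b) \<in> out_arc N t x"
      | a z where "Pos (Tok a) \<in> out_arc N t x" "Bond b \<in> con a (assemble N B l z)"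
      unfolding mem_fire by blast
    then show "b \<in> B \<union> made N t \<and> (\<forall>c\<in>set_uprod b. fired_loc N t B l c = x)"
    proof cases
      case 1
      \<comment> \<open>A bond left over in its old place has no end in a moved component, for
        otherwise the whole component, bond included, would have been removed.\<close>
      have "\<not> (\<exists>a \<in> used N t. (a, c) \<in> conn B)" if c: "c \<in> set_uprod b" for c
      proof
        assume "\<exists>a \<in> used N t. (a, c) \<in> conn B"
        then obtain a where a: "a \<in> used N t" "(a, c) \<in> conn B" by blast
        then have "l a = x" using 1(1) c located_conn[OF loc a(2)] by auto
        moreover have "a \<in> tokens N" using a(1) used_tokens by blast
        ultimately have "Bond b \<in> con a (assemble N B l x)" using Bond_con[OF loc] 1(1) c a(2) by auto
        then show False using 1(2) inp[OF a(1)] \<open>l a = x\<close> by blast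
      qed
      then show ?thesis using 1(1) fired_loc_unmoved[of t] by simp
    next
      case 2
      then show ?thesis using fired_loc_moved[OF en out_arc_closed[OF 2] conn_refl] by (auto simp: made_def)
    next
      case 3
      then obtain c where c: "b \<in> B" "c \<in> set_uprod b" "(a, c) \<in> conn B" using Bond_con[OF loc] by blast
      then have "(a, d) \<in> conn B" if "d \<in> set_uprod b" for d
        using that conn_trans[OF c(3) conn_bond[OF c(1,2)]] by blast
      then show ?thesis using c(1) fired_loc_moved[OF en 3(1)] by simp
    qed
  next
    assume R: "b \<in> B \<union> made N t \<and> (\<forall>c\<in>set_uprod b. fired_loc N t B l c = x)"
    obtain c where c: "c \<in> set_uprod b" using uprod_nonempty[of b] by blast
    show "Bond b \<in> fire_marking N (assemble N B l) t x"
    proof (cases "b \<in> made N t")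
      case True
      then obtain y where y: "Pos (Bond b) \<in> out_arc N t y" by (auto simp: made_def)
      then have "Pos (Tok c) \<in> out_arc N t y" using out_arc_closed[OF _ c] by simp
      then have "y = x" using fired_loc_moved[OF en _ conn_refl] R c by blast
      then show ?thesis using y unfolding mem_fire by blast
    next
      case False
      then have b: "b \<in> B" using R by blast
      show ?thesis
      proof (cases "\<exists>a \<in> used N t. (a, c) \<in> conn B")
        case True
        then obtain a y where a: "Pos (Tok a) \<in> out_arc N t y" "(a, c) \<in> conn B" by (auto simp: used_def)
        then have "y = x" using fired_loc_moved[OF en a] R c by blast
        moreover have "Bond b \<in> con a (assemble N B l (l a))"
          using Bond_con[OF loc] b c a outu[OF a(1)] by blast
        ultimately show ?thesis using inp[of a] outu[OF a(1)] a(1) unfolding mem_fire by blast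
      next
        case False
        have no: "\<not> (\<exists>a \<in> used N t. (a, d) \<in> conn B)" if "d \<in> set_uprod b" for d
          using False conn_trans[OF _ conn_bond[OF b that c]] by blast
        then have "\<forall>d\<in>set_uprod b. l d = x" using R fired_loc_unmoved[of t] by simp
        moreover have "Bond b \<notin> con a (assemble N B l x)" if "Pos (Tok a) \<in> in_arc N x t" for a
          using Bond_con[OF loc, of b a x] no used_iff_in[of a t] that by blast
        moreover have "Bond b \<in> assemble N B l x" using b calculation(1) by simp
        ultimately show ?thesis unfolding mem_fire by blast
      qed
    qed
  qed
  show ?thesis
  proof (intro ext set_eqI)
    fix x i show "i \<in> fire_marking N (assemble N B l) t x \<longleftrightarrow> i \<in> assemble N (B \<union> made N t) (fired_loc N t B l) x"
      using tok bond by (cases i) auto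
  qed
qed


section \<open>Reversing and commuting firings of markings\<close>

lemma mem_reverse: "i \<in> reverse_marking N M t x \<longleftrightarrow>
    i \<in> M x \<and> (\<forall>a. Pos (Tok a) \<in> out_arc N t x \<longrightarrow> i \<notin> con a (M x)) \<or>
    (\<exists>a y. Pos (Tok a) \<in> in_arc N x t \<and> y \<in> out_places N t \<and> i \<in> con a (M y - effect N t))"
  by (auto simp: reverse_marking_def)

text \<open>The reversal lifts the components as joined by the new bonds, deletes the bonds of
  \<open>effect\<close> and distributes what is left by component. As the deletion recovers
  \<open>B\<close>, the pieces put back are the original components.\<close>

lemma reverse_fire_marking:
  assumes loc: "located N B l" and en: "fires_at N B l t"
  shows "reverse_marking N (fire_marking N (assemble N B l) t) t = assemble N B l"
proof -
  let ?B = "B \<union> made N t" and ?l = "fired_loc N t B l"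
  have loc': "located N ?B ?l" using located_fire[OF assms] .
  have loc'': "located N B ?l" using loc' unfolding located_def by blast
  \<comment> \<open>A made bond that was already in \<open>B\<close> is a required one, and required
    bonds are in \<open>B\<close>; so \<open>effect N t\<close> is exactly what was added to
    \<open>B\<close>.\<close>
  have eff: "assemble N ?B ?l x - effect N t = assemble N B ?l x" for x
    using en needed_made[of t] by (auto simp: fires_at_def effect_eq assemble_def)
  have mem: "i \<in> reverse_marking N (fire_marking N (assemble N B l) t) t x \<longleftrightarrow>
     i \<in> assemble N ?B ?l x \<and> (\<forall>a. Pos (Tok a) \<in> out_arc N t x \<longrightarrow> i \<notin> con a (assemble N ?B ?l x)) \<or>
     (\<exists>a y. Pos (Tok a) \<in> in_arc N x t \<and> y \<in> out_places N t \<and> i \<in> con a (assemble N B ?l y))" for i x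
    unfolding mem_reverse fire_assemble[OF assms] eff ..
  have used: "Pos (Tok a) \<in> in_arc N (l a) t \<and> a \<in> tokens N \<and> ?l a \<in> out_places N t \<and> Pos (Tok a) \<in> out_arc N t (?l a)"
    if a: "a \<in> used N t" for a
  proof -
    obtain x where x: "Pos (Tok a) \<in> in_arc N x t" using a used_iff_in by blast
    then have "x = l a" using en unfolding fires_at_def by blast
    obtain y where y: "Pos (Tok a) \<in> out_arc N t y" using a by (auto simp: used_def)
    then have "?l a = y" using fired_loc_moved[OF en y conn_refl] by simp
    moreover have "a \<in> tokens N" using that used_tokens[of t] by blast
    ultimately show ?thesis using x y \<open>x = l a\<close> out_arc_places[OF y] by simp
  qed
  have inu: "a \<in> used N t \<and> l a = x" if "Pos (Tok a) \<in> in_arc N x t" for a x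
    using that used_iff_in[of a t] en unfolding fires_at_def by blast
  have outu: "a \<in> used N t" if "Pos (Tok a) \<in> out_arc N t x" for a x
    using that by (auto simp: used_def)
  \<comment> \<open>The tokens lifted by the reversal, measured with the new bonds, are those moved
    by the firing, measured with the old ones.\<close>
  have reach_eq: "(\<exists>a\<in>used N t. (a, c) \<in> conn ?B) \<longleftrightarrow> (\<exists>a\<in>used N t. (a, c) \<in> conn B)" for c
    by (rule conn_extend) (use made_used[of _ t] in blast)
  have sub: "(a, c) \<in> conn ?B" if "(a, c) \<in> conn B" for a c
    using that conn_mono[of B ?B] by blast
  have tok: "Tok c \<in> reverse_marking N (fire_marking N (assemble N B l) t) t x \<longleftrightarrow> c \<in> tokens N \<and> l c = x" for c x
  proof (cases "\<exists>a\<in>used N t. (a, c) \<in> conn B")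
    case True
    then obtain a where a: "a \<in> used N t" "(a, c) \<in> conn B" by blast
    have lc: "l c = l a" "?l c = ?l a"
      using located_conn[OF loc a(2)] located_conn[OF loc'' a(2)] by simp_all
    have c: "c \<in> tokens N" using located_conn_tokens[OF loc a(2)] used[OF a(1)] by simp
    have no: "\<not> (Tok c \<in> assemble N ?B ?l x \<and> (\<forall>a. Pos (Tok a) \<in> out_arc N t x \<longrightarrow> Tok c \<notin> con a (assemble N ?B ?l x)))"
    proof
      assume *: "Tok c \<in> assemble N ?B ?l x \<and> (\<forall>a. Pos (Tok a) \<in> out_arc N t x \<longrightarrow> Tok c \<notin> con a (assemble N ?B ?l x))"
      then have "?l a = x" using lc by simp
      moreover from this have "Tok c \<in> con a (assemble N ?B ?l x)"
        using Tok_con[OF loc'] used[OF a(1)] sub[OF a(2)] by simp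
      ultimately show False using * used[OF a(1)] by metis
    qed
    show ?thesis
    proof
      assume "Tok c \<in> reverse_marking N (fire_marking N (assemble N B l) t) t x"
      then obtain a' y where a': "Pos (Tok a') \<in> in_arc N x t" "Tok c \<in> con a' (assemble N B ?l y)"
        using no unfolding mem by blast
      then have "(a', c) \<in> conn B" using Tok_con[OF loc''] by blast
      then show "c \<in> tokens N \<and> l c = x" using located_conn[OF loc] inu[OF a'(1)] c by metis
    next
      assume "c \<in> tokens N \<and> l c = x"
      then have "Pos (Tok a) \<in> in_arc N x t" using lc used[OF a(1)] by simp
      moreover have "Tok c \<in> con a (assemble N B ?l (?l a))"
        using Tok_con[OF loc''] used[OF a(1)] a(2) by simp
      ultimately show "Tok c \<in> reverse_marking N (fire_marking N (assemble N B l) t) t x"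
        using used[OF a(1)] unfolding mem by blast
    qed
  next
    case False
    then have False': "\<not> (\<exists>a\<in>used N t. (a, c) \<in> conn ?B)" unfolding reach_eq .
    have "Tok c \<notin> con a (assemble N B ?l y)" if "Pos (Tok a) \<in> in_arc N x t" for a y
      using Tok_con[OF loc'', of c a y] inu[OF that] False by blast
    moreover have "Tok c \<notin> con a (assemble N ?B ?l x)" if "Pos (Tok a) \<in> out_arc N t x" for a
      using Tok_con[OF loc', of c a x] outu[OF that] False' by blast
    ultimately have "Tok c \<in> reverse_marking N (fire_marking N (assemble N B l) t) t x \<longleftrightarrow> Tok c \<in> assemble N ?B ?l x"
      unfolding mem by blast
    then show ?thesis using fired_loc_unmoved[OF False] by simp
  qed
  have bond: "Bond b \<in> reverse_marking N (fire_marking N (assemble N B l) t) t x \<longleftrightarrow> b \<in> B \<and> (\<forall>c\<in>set_uprod b. l c = x)" for b x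
  proof (cases "\<exists>c\<in>set_uprod b. \<exists>a\<in>used N t. (a, c) \<in> conn B")
    case True
    then obtain a c where a: "c \<in> set_uprod b" "a \<in> used N t" "(a, c) \<in> conn B" by blast
    have lc: "l c = l a" "?l c = ?l a"
      using located_conn[OF loc a(3)] located_conn[OF loc'' a(3)] by simp_all
    have no: "\<not> (Bond b \<in> assemble N ?B ?l x \<and> (\<forall>a. Pos (Tok a) \<in> out_arc N t x \<longrightarrow> Bond b \<notin> con a (assemble N ?B ?l x)))"
    proof
      assume *: "Bond b \<in> assemble N ?B ?l x \<and> (\<forall>a. Pos (Tok a) \<in> out_arc N t x \<longrightarrow> Bond b \<notin> con a (assemble N ?B ?l x))"
      then have "?l a = x" "b \<in> ?B" using lc a(1) by auto
      moreover from this have "Bond b \<in> con a (assemble N ?B ?l x)"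
        using Bond_con[OF loc', of b a x] used[OF a(2)] sub[OF a(3)] a(1) by blast
      ultimately show False using * used[OF a(2)] by metis
    qed
    show ?thesis
    proof
      assume "Bond b \<in> reverse_marking N (fire_marking N (assemble N B l) t) t x"
      then obtain a' y where a': "Pos (Tok a') \<in> in_arc N x t" "Bond b \<in> con a' (assemble N B ?l y)"
        using no unfolding mem by blast
      then obtain d where d: "b \<in> B" "d \<in> set_uprod b" "(a', d) \<in> conn B" using Bond_con[OF loc''] by blast
      then have "l d = x" using located_conn[OF loc d(3)] inu[OF a'(1)] by simp
      then show "b \<in> B \<and> (\<forall>c\<in>set_uprod b. l c = x)" using located_bond[OF loc d(1,2)] d(1) by simp
    next
      assume *: "b \<in> B \<and> (\<forall>c\<in>set_uprod b. l c = x)"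
      then have "Pos (Tok a) \<in> in_arc N x t" using lc used[OF a(2)] a(1) by simp
      moreover have "Bond b \<in> con a (assemble N B ?l (?l a))"
        using Bond_con[OF loc'', of b a "?l a"] used[OF a(2)] a(1,3) * by blast
      ultimately show "Bond b \<in> reverse_marking N (fire_marking N (assemble N B l) t) t x"
        using used[OF a(2)] unfolding mem by blast
    qed
  next
    case False
    then have False': "\<not> (\<exists>c\<in>set_uprod b. \<exists>a\<in>used N t. (a, c) \<in> conn ?B)" unfolding reach_eq .
    have "b \<notin> made N t"
      using made_used[of b t] False uprod_nonempty[of b] conn_refl[of _ B] by blast
    have "Bond b \<notin> con a (assemble N B ?l y)" if "Pos (Tok a) \<in> in_arc N x t" for a y
      using Bond_con[OF loc'', of b a y] inu[OF that] False by blast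
    moreover have "Bond b \<notin> con a (assemble N ?B ?l x)" if "Pos (Tok a) \<in> out_arc N t x" for a
      using Bond_con[OF loc', of b a x] outu[OF that] False' by blast
    ultimately have "Bond b \<in> reverse_marking N (fire_marking N (assemble N B l) t) t x \<longleftrightarrow> Bond b \<in> assemble N ?B ?l x"
      unfolding mem by blast
    moreover have "?l c = l c" if "c \<in> set_uprod b" for c
      using fired_loc_unmoved[of t c B l] False that by blast
    ultimately show ?thesis using \<open>b \<notin> made N t\<close> by simp
  qed
  show ?thesis
  proof (intro ext set_eqI)
    fix x i show "i \<in> reverse_marking N (fire_marking N (assemble N B l) t) t x \<longleftrightarrow> i \<in> assemble N B l x"
      using tok bond by (cases i) auto
  qed
qed

text \<open>If no token of \<open>u\<close> is connected with one of \<open>t\<close> after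
  \<open>t\<close>, then none was before, and by \<open>conn_avoid\<close> the bonds made by one
  transition leave the components moved by the other unchanged. So the two act on disjoint
  components. The last two claims serve to compare dependences in
  \<open>fire_key_swap\<close>.\<close>

lemma fire_swap:
  assumes loc: "located N B l" and en: "fires_at N B l t"
    and en': "fires_at N (B \<union> made N t) (fired_loc N t B l) u"
    and indep: "\<And>a c. a \<in> used N u \<Longrightarrow> c \<in> used N t \<Longrightarrow> (a, c) \<notin> conn (B \<union> made N t)"
  shows "fires_at N B l u"
    and "fires_at N (B \<union> made N u) (fired_loc N u B l) t"
    and "fired_loc N u (B \<union> made N t) (fired_loc N t B l) = fired_loc N t (B \<union> made N u) (fired_loc N u B l)"
    and "\<And>a c. a \<in> used N u \<Longrightarrow> (a, c) \<in> conn (B \<union> made N t) \<longleftrightarrow> (a, c) \<in> conn B"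
    and "\<And>a c. a \<in> used N t \<Longrightarrow> (a, c) \<in> conn (B \<union> made N u) \<longleftrightarrow> (a, c) \<in> conn B"
proof -
  have sub: "(a, c) \<in> conn (B \<union> made N t)" if "(a, c) \<in> conn B" for a c
    using that conn_mono[of B "B \<union> made N t"] by blast
  have ind: "(a, c) \<notin> conn B" if "a \<in> used N u" "c \<in> used N t" for a c
    using indep[OF that] sub by blast
  show conn_u: "(a, c) \<in> conn (B \<union> made N t) \<longleftrightarrow> (a, c) \<in> conn B" if "a \<in> used N u" for a c
    by (rule conn_avoid[where S = "used N t"]) (use made_used[of _ t] ind[OF that] in blast)+
  show conn_t: "(a, c) \<in> conn (B \<union> made N u) \<longleftrightarrow> (a, c) \<in> conn B" if "a \<in> used N t" for a c
    by (rule conn_avoid[where S = "used N u"]) (use made_used[of _ u] ind[OF _ that] conn_sym[of a _ B] in blast)+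
  have outu: "a \<in> used N v" if "Pos (Tok a) \<in> out_arc N v x" for a x v
    using that by (auto simp: used_def)
  have inu: "a \<in> used N v" if "Pos (Tok a) \<in> in_arc N x v" for a x v
    using that used_iff_in[of a v] by blast
  \<comment> \<open>A bond made by both would have an end used by both, and a token is connected
    with itself.\<close>
  have disj: "made N u \<inter> made N t = {}"
  proof -
    have False if "b \<in> made N u" "b \<in> made N t" for b
      using made_used[OF that(1)] made_used[OF that(2)] uprod_nonempty[of b] ind conn_refl[of _ B] by blast
    then show ?thesis by blast
  qed
  have stay_u: "fired_loc N t B l c = l c" if "a \<in> used N u" "(a, c) \<in> conn B" for a c
    by (rule fired_loc_unmoved) (use ind[OF that(1)] conn_trans[OF that(2) conn_sym] in blast)
  have stay_t: "fired_loc N u B l c = l c" if "a \<in> used N t" "(a, c) \<in> conn B" for a c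
    by (rule fired_loc_unmoved) (use ind[OF _ that(1)] conn_trans[OF _ conn_sym[OF that(2)]] in blast)
  show en_u: "fires_at N B l u"
    unfolding fires_at_def
  proof (intro conjI allI impI)
    fix x a assume "Pos (Tok a) \<in> in_arc N x u"
    then show "l a = x" using en' stay_u[OF inu conn_refl] unfolding fires_at_def by metis
  next
    \<comment> \<open>Required bonds reappear on the outgoing arcs, so by disjointness
      \<open>u\<close> requires no bond made by \<open>t\<close>.\<close>
    have "needed N u \<subseteq> B \<union> made N t" using en' by (auto simp: fires_at_def)
    then show "needed N u \<subseteq> B" using disj needed_made[of u] by blast
  next
    fix y1 y2 a b
    assume "Pos (Tok a) \<in> out_arc N u y1 \<and> Pos (Tok b) \<in> out_arc N u y2 \<and> (a, b) \<in> conn B"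
    then show "y1 = y2" using en' sub[of a b] unfolding fires_at_def by blast
  next
    have "made N u \<inter> (B \<union> made N t) \<subseteq> needed N u" using en' by (simp add: fires_at_def)
    then show "made N u \<inter> B \<subseteq> needed N u" by blast
  qed
  show en_t: "fires_at N (B \<union> made N u) (fired_loc N u B l) t"
    unfolding fires_at_def
  proof (intro conjI allI impI)
    fix x a assume "Pos (Tok a) \<in> in_arc N x t"
    then show "fired_loc N u B l a = x" using en stay_t[OF inu conn_refl] unfolding fires_at_def by metis
  next
    show "needed N t \<subseteq> B \<union> made N u" using en by (auto simp: fires_at_def)
  next
    fix y1 y2 a b
    assume *: "Pos (Tok a) \<in> out_arc N t y1 \<and> Pos (Tok b) \<in> out_arc N t y2 \<and> (a, b) \<in> conn (B \<union> made N u)"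
    then have "(a, b) \<in> conn B" using conn_t[OF outu] by blast
    then show "y1 = y2" using en * unfolding fires_at_def by blast
  next
    have "made N t \<inter> B \<subseteq> needed N t" using en by (simp add: fires_at_def)
    then show "made N t \<inter> (B \<union> made N u) \<subseteq> needed N t" using disj by blast
  qed
  show "fired_loc N u (B \<union> made N t) (fired_loc N t B l) = fired_loc N t (B \<union> made N u) (fired_loc N u B l)"
  proof
    fix c
    show "fired_loc N u (B \<union> made N t) (fired_loc N t B l) c = fired_loc N t (B \<union> made N u) (fired_loc N u B l) c"
    proof (cases "\<exists>a\<in>used N u. (a, c) \<in> conn B")
      case True
      then obtain a y where a: "Pos (Tok a) \<in> out_arc N u y" "(a, c) \<in> conn B" by (auto simp: used_def)
      have "\<not> (\<exists>d \<in> used N t. (d, c) \<in> conn (B \<union> made N u))"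
        using conn_t ind[OF outu[OF a(1)]] conn_trans[OF a(2) conn_sym] by blast
      then have "fired_loc N t (B \<union> made N u) (fired_loc N u B l) c = fired_loc N u B l c"
        by (rule fired_loc_unmoved)
      then show ?thesis using fired_loc_moved[OF en' a(1) sub[OF a(2)]] fired_loc_moved[OF en_u a] by simp
    next
      case False
      then have "\<not> (\<exists>a\<in>used N u. (a, c) \<in> conn (B \<union> made N t))" using conn_u by blast
      then have 1: "fired_loc N u (B \<union> made N t) (fired_loc N t B l) c = fired_loc N t B l c" by (rule fired_loc_unmoved)
      show ?thesis
      proof (cases "\<exists>a\<in>used N t. (a, c) \<in> conn B")
        case True
        then obtain a y where a: "Pos (Tok a) \<in> out_arc N t y" "(a, c) \<in> conn B" by (auto simp: used_def)
        then show ?thesis unfolding 1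
          using fired_loc_moved[OF en_t a(1), of c] fired_loc_moved[OF en a] conn_t[OF outu[OF a(1)]] by simp
      next
        case F: False
        then have "\<not> (\<exists>a\<in>used N t. (a, c) \<in> conn (B \<union> made N u))" using conn_t by blast
        then show ?thesis unfolding 1
          using fired_loc_unmoved[OF F] fired_loc_unmoved[of t c "B \<union> made N u" "fired_loc N u B l"] fired_loc_unmoved[OF False] by simp
      qed
    qed
  qed
qed

end

section \<open>Weakly reachable states\<close>

text \<open>Firing with an arbitrary key: to invert a reversal exactly, the key of the reversed occurrence
  has to be used again, which need not be the largest one.\<close>

definition touching :: "('a, 'p, 't) rpn \<Rightarrow> ('a, 'p, 't) state \<Rightarrow> 't \<Rightarrow> ('t occurrence) set" where
  "touching N s t = {(t', k'). t' \<in> transitions N \<and> k' \<in> history s t' \<and>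
     (\<exists>x \<in> in_places N t. \<exists>a. Pos (Tok a) \<in> in_arc N x t \<and> con a (marking s x) \<inter> post_items N t' \<noteq> {})}"

definition fire_key :: "('a, 'p, 't) rpn \<Rightarrow> ('a, 'p, 't) state \<Rightarrow> 't \<Rightarrow> nat \<Rightarrow> ('a, 'p, 't) state" where
  "fire_key N s t k =
     \<lparr>marking = fire_marking N (marking s) t,
      history = (history s)(t := insert k (history s t)),
      dependence = dependence s \<union> touching N s t \<times> {(t, k)}\<rparr>"

lemma fire_key_simps [simp]:
  "marking (fire_key N s t k) = fire_marking N (marking s) t"
  "history (fire_key N s t k) = (history s)(t := insert k (history s t))"
  "dependence (fire_key N s t k) = dependence s \<union> touching N s t \<times> {(t, k)}"
  by (simp_all add: fire_key_def)

lemma reverse_simps [simp]: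
  "marking (reverse N s t) = reverse_marking N (marking s) t"
  "history (reverse N s t) = (history s)(t := history s t - {last_key s t})"
  "dependence (reverse N s t) = {(o1, o2) \<in> dependence s. o1 \<noteq> (t, last_key s t) \<and> o2 \<noteq> (t, last_key s t)}"
  by (simp_all add: reverse_def)

lemma touching_live: "(t', k') \<in> touching N s t \<Longrightarrow> k' \<in> history s t'"
  by (auto simp: touching_def)

text \<open>Reversal has no rule of its own, since deleting an occurrence without dependents from a
  sequence of firings gives such a sequence again (\<open>weakly_reachable_reverse\<close>).
  Deletions leave gaps, so the key of a firing may be any number above the live keys.\<close>

inductive weakly_reachable :: "('a, 'p, 't) rpn \<Rightarrow> ('a, 'p) marking \<Rightarrow> ('a, 'p, 't) state \<Rightarrow> bool" for N M0 where
  init: "weakly_reachable N M0 (initial_state M0)"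
| fire_key: "weakly_reachable N M0 s \<Longrightarrow> t \<in> transitions N \<Longrightarrow> weakly_enabled N (marking s) t \<Longrightarrow>
    (\<And>k'. k' \<in> keys N s \<Longrightarrow> k' < k) \<Longrightarrow> weakly_reachable N M0 (fire_key N s t k)"

context reversing_net
begin

definition proper :: "('a, 'p) marking \<Rightarrow> bool" where
  "proper M \<longleftrightarrow> (\<exists>B l. located N B l \<and> M = assemble N B l)"

lemma proper_fire: "proper M \<Longrightarrow> weakly_enabled N M t \<Longrightarrow> proper (fire_marking N M t)"
  unfolding proper_def using weakly_enabled_assemble fire_assemble located_fire by metis

text \<open>Tokens suffice to express \<open>touching\<close>: if the component meets a bond on an
  outgoing arc of \<open>t'\<close>, the ends of that bond are tokens of \<open>t'\<close>.\<close>

lemma touching_iff: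
  assumes loc: "located N B l" and en: "fires_at N B l t" and M: "marking s = assemble N B l"
  shows "(t', k') \<in> touching N s t \<longleftrightarrow>
    t' \<in> transitions N \<and> k' \<in> history s t' \<and> (\<exists>a\<in>used N t. \<exists>c\<in>used N t'. (a, c) \<in> conn B)"
proof -
  have "(\<exists>x \<in> in_places N t. \<exists>a. Pos (Tok a) \<in> in_arc N x t \<and> con a (marking s x) \<inter> post_items N t' \<noteq> {})
    \<longleftrightarrow> (\<exists>a\<in>used N t. \<exists>c\<in>used N t'. (a, c) \<in> conn B)" (is "?L \<longleftrightarrow> ?R")
  proof
    assume ?L
    then obtain x a i where i: "Pos (Tok a) \<in> in_arc N x t" "i \<in> con a (assemble N B l x)" "i \<in> post_items N t'"
      unfolding M by blast
    have a: "a \<in> used N t" using i(1) used_iff_in[of a t] by blast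
    have "\<exists>c\<in>used N t'. (a, c) \<in> conn B"
    proof (cases i)
      case (Tok c)
      then show ?thesis using i(2,3) Tok_con[OF loc, of c a x] by (auto simp: post_items_eq)
    next
      case (Bond b)
      then have "b \<in> made N t'" using i(3) by (auto simp: post_items_eq)
      then show ?thesis using i(2) Bond_con[OF loc, of b a x] made_used[of b t'] Bond by blast
    qed
    then show ?R using a by blast
  next
    assume ?R
    then obtain a c where a: "a \<in> used N t" "c \<in> used N t'" "(a, c) \<in> conn B" by blast
    obtain x where x: "Pos (Tok a) \<in> in_arc N x t" using a(1) used_iff_in[of a t] by blast
    have "l a = x" using en x unfolding fires_at_def by blast
    then have "Tok c \<in> con a (marking s x)"
      unfolding M using Tok_con[OF loc, of c a x] a used_tokens[of t] by blast
    moreover have "Tok c \<in> post_items N t'" using a(2) by (simp add: post_items_eq)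
    ultimately show ?L using x in_arc_places[OF x] by blast
  qed
  then show ?thesis by (simp add: touching_def)
qed

text \<open>\<open>k\<close> is compared with the keys of \<open>t\<close> only, because in
  \<open>weakly_reachable_reverse\<close> other transitions may hold larger ones. By freshness no
  old pair mentions \<open>(t, k)\<close>, so the filter in \<open>reverse\<close> removes precisely
  the pairs that the firing added.\<close>

lemma reverse_fire_key:
  assumes M: "proper (marking s)" and en: "weakly_enabled N (marking s) t" 
    and fin: "finite (history s t)" and less: "\<forall>k' \<in> history s t. k' < k"
    and fresh: "\<And>o'. ((t, k), o') \<notin> dependence s \<and> (o', (t, k)) \<notin> dependence s"
  shows "last_key (fire_key N s t k) t = k" and "reverse N (fire_key N s t k) t = s" and "co_enabled N (fire_key N s t k) t"
proof -
  have new: "k \<notin> history s t" using less by blast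
  have "Max (insert k (history s t)) = k"
    using fin less by (intro Max_eqI) (auto intro: less_imp_le)
  then show last: "last_key (fire_key N s t k) t = k" by (simp add: last_key_def)
  obtain B l where Bl: "located N B l" "marking s = assemble N B l" using M by (auto simp: proper_def)
  have "fires_at N B l t" using en weakly_enabled_assemble[OF Bl(1)] Bl(2) by simp
  then have "reverse_marking N (fire_marking N (marking s) t) t = marking s"
    using reverse_fire_marking[OF Bl(1)] Bl(2) by simp
  moreover have "(t, k) \<notin> touching N s t" using touching_live new by metis
  moreover have "{(o1, o2). (o1, o2) \<in> dependence s \<union> touching N s t \<times> {(t, k)} \<and> o1 \<noteq> (t, k) \<and> o2 \<noteq> (t, k)} = dependence s"
    using fresh by auto
  ultimately show "reverse N (fire_key N s t k) t = s"
    using new by (intro state.equality) (simp_all add: last)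
  show "co_enabled N (fire_key N s t k) t"
    unfolding co_enabled_def last using fresh \<open>(t, k) \<notin> touching N s t\<close>
    by (auto simp: fire_marking_def)
qed

text \<open>\<open>fire_swap\<close> lifted to states. Keys travel with their transitions, and the
  dependences agree because each transition sees the same connections in both orders and neither
  touches the other.\<close>

lemma fire_key_swap:
  assumes M: "proper (marking s)" and t: "t \<in> transitions N" and en: "weakly_enabled N (marking s) t"
    and en': "weakly_enabled N (marking (fire_key N s t k)) u" and indep: "(t, k) \<notin> touching N (fire_key N s t k) u"
  shows "weakly_enabled N (marking s) u" and "weakly_enabled N (marking (fire_key N s u j)) t"
    and "fire_key N (fire_key N s t k) u j = fire_key N (fire_key N s u j) t k"
proof -
  obtain B l where loc: "located N B l" and Ms: "marking s = assemble N B l" using M by (auto simp: proper_def)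
  have e: "fires_at N B l t" using en weakly_enabled_assemble[OF loc] Ms by simp
  have loc': "located N (B \<union> made N t) (fired_loc N t B l)" by (rule located_fire[OF loc e])
  have Mt: "marking (fire_key N s t k) = assemble N (B \<union> made N t) (fired_loc N t B l)"
    using fire_assemble[OF loc e] Ms by simp
  have e': "fires_at N (B \<union> made N t) (fired_loc N t B l) u" using en' weakly_enabled_assemble[OF loc'] Mt by simp
  have ind: "(a, c) \<notin> conn (B \<union> made N t)" if "a \<in> used N u" "c \<in> used N t" for a c
    using indep that t unfolding touching_iff[OF loc' e' Mt] by auto
  note sw = fire_swap[OF loc e e' ind]
  have eu: "fires_at N B l u" and et: "fires_at N (B \<union> made N u) (fired_loc N u B l) t" using sw(1,2) by auto
  have locu: "located N (B \<union> made N u) (fired_loc N u B l)" by (rule located_fire[OF loc eu])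
  have Mu: "marking (fire_key N s u j) = assemble N (B \<union> made N u) (fired_loc N u B l)"
    using fire_assemble[OF loc eu] Ms by simp
  show "weakly_enabled N (marking s) u" using eu weakly_enabled_assemble[OF loc] Ms by simp
  show "weakly_enabled N (marking (fire_key N s u j)) t" using et weakly_enabled_assemble[OF locu] Mu by simp
  have marks: "fire_marking N (marking (fire_key N s t k)) u = fire_marking N (marking (fire_key N s u j)) t"
    unfolding Mt Mu fire_assemble[OF loc' e'] fire_assemble[OF locu et]
    using sw(3) by (simp add: Un_ac)
  have cu: "(a, c) \<in> conn (B \<union> made N t) \<longleftrightarrow> (a, c) \<in> conn B" if "a \<in> used N u" for a c
    using sw(4) that by simp
  have ct: "(a, c) \<in> conn (B \<union> made N u) \<longleftrightarrow> (a, c) \<in> conn B" if "a \<in> used N t" for a c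
    using sw(5) that by simp
  have no: "(a, c) \<notin> conn B" "(c, a) \<notin> conn B" if "a \<in> used N u" "c \<in> used N t" for a c
    using ind[OF that] cu[OF that(1)] conn_sym[of c a B] by blast+
  have no': "\<not> (\<exists>a\<in>used N u. \<exists>c\<in>used N t. (a, c) \<in> conn B)" "\<not> (\<exists>a\<in>used N t. \<exists>c\<in>used N u. (a, c) \<in> conn B)"
    using no by blast+
  have "o' \<in> touching N (fire_key N s t k) u \<longleftrightarrow> o' \<in> touching N s u" for o'
  proof (cases o')
    \<comment> \<open>Firing \<open>t\<close> changes the live occurrences of \<open>t\<close> only,
      and no token of \<open>u\<close> is connected with one of \<open>t\<close>, so for
      \<open>t' = t\<close> both sides are false.\<close>
    case (Pair t' k')
    show ?thesis unfolding Pair touching_iff[OF loc' e' Mt] touching_iff[OF loc eu Ms]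
      using cu no'(1) by (cases "t' = t") auto
  qed
  moreover have "o' \<in> touching N (fire_key N s u j) t \<longleftrightarrow> o' \<in> touching N s t" for o'
  proof (cases o')
    case (Pair t' k')
    show ?thesis unfolding Pair touching_iff[OF locu et Mu] touching_iff[OF loc e Ms]
      using ct no'(2) by (cases "t' = u") auto
  qed
  ultimately have "touching N (fire_key N s t k) u = touching N s u" "touching N (fire_key N s u j) t = touching N s t"
    by blast+
  then show "fire_key N (fire_key N s t k) u j = fire_key N (fire_key N s u j) t k"
    using marks by (intro state.equality) (auto simp: fun_eq_iff)
qed

text \<open>\<open>l\<close> is the unique place of a token and \<open>B\<close> collects the bonds
  of all places. By bond closure each bond lies with its ends, so its place can be recovered from
  \<open>l\<close>.\<close>

lemma proper_initial:
  assumes "initial_marking N M0"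
  shows "proper M0"
proof -
  define l where "l a = (THE x. x \<in> places N \<and> Tok a \<in> M0 x)" for a
  define B where "B = {b. \<exists>x. Bond b \<in> M0 x}"
  have items: "i \<in> items N" "x \<in> places N" if "i \<in> M0 x" for i x
    using that assms unfolding initial_marking_def by blast+
  have l: "a \<in> tokens N \<and> l a = x \<longleftrightarrow> Tok a \<in> M0 x" for a x
  proof
    assume a: "a \<in> tokens N \<and> l a = x"
    then have "\<exists>!x. x \<in> places N \<and> Tok a \<in> M0 x" using assms by (simp add: initial_marking_def)
    from theI'[OF this] show "Tok a \<in> M0 x" using a by (simp add: l_def)
  next
    assume a: "Tok a \<in> M0 x"
    then have a': "a \<in> tokens N" "x \<in> places N" using items[OF a] by simp_all
    then have "\<exists>!x. x \<in> places N \<and> Tok a \<in> M0 x" using assms by (simp add: initial_marking_def)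
    then have "l a = x" unfolding l_def using a a' by (intro the1_equality) auto
    then show "a \<in> tokens N \<and> l a = x" using a' by simp
  qed
  have closed: "Tok a \<in> M0 x" if "Bond b \<in> M0 x" "a \<in> set_uprod b" for a b x
  proof -
    have "bond_closed (M0 x)" using assms by (simp add: initial_marking_def)
    then have "Tok ` set_uprod b \<subseteq> M0 x" using that(1) by (simp add: bond_closed_def)
    then show ?thesis using that(2) by blast
  qed
  have "located N B l"
    unfolding located_def B_def
  proof (intro conjI ballI subsetI)
    fix b a c assume "b \<in> {b. \<exists>x. Bond b \<in> M0 x}" and ac: "a \<in> set_uprod b" "c \<in> set_uprod b"
    then obtain x where "Bond b \<in> M0 x" by blast
    then show "l a = l c" using closed ac l by metis
  qed (use items in force)
  moreover have "M0 = assemble N B l"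
  proof (intro ext set_eqI)
    fix x i show "i \<in> M0 x \<longleftrightarrow> i \<in> assemble N B l x"
    proof (cases i)
      case (Bond b)
      have "Bond b \<in> M0 x" if "Bond b \<in> M0 y" "\<forall>a\<in>set_uprod b. l a = x" for y
        using that closed[of b y] uprod_nonempty[of b] l by metis
      then show ?thesis unfolding Bond using closed[of b x] l by (auto simp: B_def)
    qed (simp add: l)
  qed
  ultimately show ?thesis by (auto simp: proper_def)
qed

end

locale initialised_net = reversing_net N for N :: "('a, 'p, 't) rpn" +
  fixes M0 :: "('a, 'p) marking"
  assumes initial: "initial_marking N M0"
begin

text \<open>The claims on \<open>used\<close> say that transitions without tokens are isolated in
  the dependence relation, while any two occurrences of another transition are comparable;
  \<open>renames_last_key\<close> rests on this.\<close>

lemma weakly_reachable_invariant: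
  assumes "weakly_reachable N M0 s"
  shows "proper (marking s)" 
    and "finite (history s t)" and "k \<in> history s t \<Longrightarrow> t \<in> transitions N"
    and "((t, k), (t', k')) \<in> dependence s \<Longrightarrow> k \<in> history s t \<and> k' \<in> history s t' \<and> k < k' \<and> used N t \<noteq> {}"
    and "k \<in> history s t \<Longrightarrow> k \<in> history s t' \<Longrightarrow> t = t'"
    and "used N t \<noteq> {} \<Longrightarrow> k \<in> history s t \<Longrightarrow> k' \<in> history s t \<Longrightarrow> k < k' \<Longrightarrow> ((t, k), (t, k')) \<in> dependence s"
    and "((t, k), (t', k')) \<in> dependence s \<Longrightarrow> used N t' \<noteq> {}"
proof -
  have "proper (marking s) \<and> (\<forall>t. finite (history s t)) \<and> (\<forall>t k. k \<in> history s t \<longrightarrow> t \<in> transitions N) \<and>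
    (\<forall>t k t' k'. ((t, k), (t', k')) \<in> dependence s \<longrightarrow> k \<in> history s t \<and> k' \<in> history s t' \<and> k < k' \<and> used N t \<noteq> {} \<and> used N t' \<noteq> {}) \<and>
    (\<forall>t k t'. k \<in> history s t \<longrightarrow> k \<in> history s t' \<longrightarrow> t = t') \<and>
    (\<forall>t k k'. used N t \<noteq> {} \<longrightarrow> k \<in> history s t \<longrightarrow> k' \<in> history s t \<longrightarrow> k < k' \<longrightarrow> ((t, k), (t, k')) \<in> dependence s)"
    using assms
  proof induction
    case init
    then show ?case using proper_initial[OF initial] by (simp add: initial_state_def)
  next
    case (fire_key s u j)
    have M: "proper (marking s)" and fin: "\<And>t. finite (history s t)"
      and T: "\<And>t k. k \<in> history s t \<Longrightarrow> t \<in> transitions N"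
      and dep: "\<And>t k t' k'. ((t, k), (t', k')) \<in> dependence s \<Longrightarrow> k \<in> history s t \<and> k' \<in> history s t' \<and> k < k' \<and> used N t \<noteq> {} \<and> used N t' \<noteq> {}"
      and uniq: "\<And>t k t'. k \<in> history s t \<Longrightarrow> k \<in> history s t' \<Longrightarrow> t = t'"
      and self: "\<And>t k k'. used N t \<noteq> {} \<Longrightarrow> k \<in> history s t \<Longrightarrow> k' \<in> history s t \<Longrightarrow> k < k' \<Longrightarrow> ((t, k), (t, k')) \<in> dependence s"
      using fire_key.IH by blast+
    have less: "k < j" if "k \<in> history s t" for k t
      using that T[OF that] fire_key.hyps(4)[of k] by (auto simp: keys_def)
    obtain B l where Bl: "located N B l" "marking s = assemble N B l" using M by (auto simp: proper_def)
    have en: "fires_at N B l u" using fire_key.hyps(3) weakly_enabled_assemble[OF Bl(1)] Bl(2) by simp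
    note tch = touching_iff[OF Bl(1) en Bl(2)]
    have "proper (marking (fire_key N s u j))" using proper_fire[OF M fire_key.hyps(3)] by simp
    moreover have "\<forall>t. finite (history (fire_key N s u j) t)" using fin by simp
    moreover have "\<forall>t k. k \<in> history (fire_key N s u j) t \<longrightarrow> t \<in> transitions N"
      using fire_key.hyps(2) by (auto intro: T)
    moreover have "\<forall>t k t' k'. ((t, k), (t', k')) \<in> dependence (fire_key N s u j) \<longrightarrow>
      k \<in> history (fire_key N s u j) t \<and> k' \<in> history (fire_key N s u j) t' \<and> k < k' \<and> used N t \<noteq> {} \<and> used N t' \<noteq> {}"
    proof (intro allI impI)
      fix t k t' k' assume "((t, k), (t', k')) \<in> dependence (fire_key N s u j)"
      then consider "((t, k), (t', k')) \<in> dependence s" | "(t, k) \<in> touching N s u" "t' = u" "k' = j" by auto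
      then show "k \<in> history (fire_key N s u j) t \<and> k' \<in> history (fire_key N s u j) t' \<and> k < k' \<and> used N t \<noteq> {} \<and> used N t' \<noteq> {}"
      proof cases
        case 1
        then show ?thesis using dep[OF 1] by auto
      next
        case 2
        then show ?thesis using less[of k t] unfolding tch by auto
      qed
    qed
    moreover have "\<forall>t k t'. k \<in> history (fire_key N s u j) t \<longrightarrow> k \<in> history (fire_key N s u j) t' \<longrightarrow> t = t'"
    proof (intro allI impI)
      fix t k t' assume "k \<in> history (fire_key N s u j) t" "k \<in> history (fire_key N s u j) t'"
      then show "t = t'" using uniq[of k t t'] less[of j t] less[of j t']
        by (cases "t = u"; cases "t' = u") auto
    qed
    moreover have "\<forall>t k k'. used N t \<noteq> {} \<longrightarrow> k \<in> history (fire_key N s u j) t \<longrightarrow> k' \<in> history (fire_key N s u j) t \<longrightarrow> k < k' \<longrightarrow>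
      ((t, k), (t, k')) \<in> dependence (fire_key N s u j)"
    proof (intro allI impI)
      fix t k k' assume *: "used N t \<noteq> {}" "k \<in> history (fire_key N s u j) t" "k' \<in> history (fire_key N s u j) t" "k < k'"
      show "((t, k), (t, k')) \<in> dependence (fire_key N s u j)"
      proof (cases "t = u \<and> k' = j")
        case True
        then have k: "k \<in> history s u" using * by auto
        \<comment> \<open>An earlier occurrence of the same transition shares the token
          \<open>a\<close>, which is connected with itself, so the new occurrence depends on
          it.\<close>
        obtain a where "a \<in> used N u" using * True by blast
        then have "(u, k) \<in> touching N s u" unfolding tch using k T[OF k] conn_refl[of a B] by blast
        then show ?thesis using True by simp
      next
        case False
        then have "k' \<in> history s t" using * by (auto split: if_splits)
        moreover from this have "k \<in> history s t" using * less[of k' t] by (auto split: if_splits)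
        ultimately show ?thesis using self[of t k k'] * by simp
      qed
    qed
    ultimately show ?case by blast
  qed
  note inv = this
  show "proper (marking s)" using inv by blast
  show "finite (history s t)" using inv by blast
  show "k \<in> history s t \<Longrightarrow> t \<in> transitions N" using inv by blast
  show "((t, k), (t', k')) \<in> dependence s \<Longrightarrow> k \<in> history s t \<and> k' \<in> history s t' \<and> k < k' \<and> used N t \<noteq> {}" using inv by blast
  show "k \<in> history s t \<Longrightarrow> k \<in> history s t' \<Longrightarrow> t = t'" using inv by blast
  show "used N t \<noteq> {} \<Longrightarrow> k \<in> history s t \<Longrightarrow> k' \<in> history s t \<Longrightarrow> k < k' \<Longrightarrow> ((t, k), (t, k')) \<in> dependence s" using inv by blast
  show "((t, k), (t', k')) \<in> dependence s \<Longrightarrow> used N t' \<noteq> {}" using inv by blast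
qed

section \<open>Reversals of weakly reachable states\<close>

lemma dead_not_dependent:
  assumes "weakly_reachable N M0 s" and "k \<notin> history s t"
  shows "((t, k), o') \<notin> dependence s \<and> (o', (t, k)) \<notin> dependence s"
  using weakly_reachable_invariant(4)[OF assms(1)] assms(2) by (cases o') blast

lemma keys_history: "weakly_reachable N M0 s \<Longrightarrow> k \<in> keys N s \<longleftrightarrow> (\<exists>t. k \<in> history s t)"
  using weakly_reachable_invariant(3) by (auto simp: keys_def)

text \<open>Induction on the sequence of firings. If the last firing is one of \<open>t\<close>, it
  is undone directly. Otherwise the occurrence is removed from the earlier state by the induction
  hypothesis, and the last firing, which does not depend on it, is moved in front of it; then the
  occurrence comes last and \<open>reverse_fire_key\<close> applies.\<close>

lemma weakly_reachable_reverse: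
  assumes "weakly_reachable N M0 s" and "history s t \<noteq> {}" and "\<forall>o'. ((t, last_key s t), o') \<notin> dependence s"
  shows "co_enabled N s t \<and> weakly_reachable N M0 (reverse N s t) \<and> weakly_enabled N (marking (reverse N s t)) t \<and>
    fire_key N (reverse N s t) t (last_key s t) = s"
  using assms
proof induction
  case init
  then show ?case by (simp add: initial_state_def)
next
  case (fire_key s u k)
  have less: "k' < k" if "k' \<in> history s v" for k' v
    using fire_key.hyps(4)[of k'] keys_history[OF fire_key.hyps(1)] that by blast
  show ?case
  proof (cases "t = u")
    case True
    have "((u, k), o') \<notin> dependence s \<and> (o', (u, k)) \<notin> dependence s" for o'
      using dead_not_dependent[OF fire_key.hyps(1)] less by blast
    note loop = reverse_fire_key[OF weakly_reachable_invariant(1)[OF fire_key.hyps(1)] fire_key.hyps(3)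
        weakly_reachable_invariant(2)[OF fire_key.hyps(1)] ballI[OF less] this]
    from loop fire_key.hyps show ?thesis by (simp only: True)
  next
    case False
    let ?k = "last_key s t" and ?r = "reverse N s t"
    have last: "last_key (fire_key N s u k) t = ?k" using False by (simp add: last_key_def)
    have ne: "history s t \<noteq> {}" using fire_key.prems(1) False by simp
    have nodep: "\<forall>o'. ((t, ?k), o') \<notin> dependence s" and indep: "(t, ?k) \<notin> touching N s u"
      using fire_key.prems(2) unfolding last by auto
    have IH: "co_enabled N s t" "weakly_reachable N M0 ?r" "weakly_enabled N (marking ?r) t" "fire_key N ?r t ?k = s"
      using fire_key.IH[OF ne nodep] by blast+
    have fin: "finite (history s t)" by (rule weakly_reachable_invariant(2)[OF fire_key.hyps(1)])
    have t: "t \<in> transitions N" using ne weakly_reachable_invariant(3)[OF fire_key.hyps(1)] by blast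
    have "weakly_enabled N (marking (fire_key N ?r t ?k)) u" "(t, ?k) \<notin> touching N (fire_key N ?r t ?k) u"
      unfolding IH(4) using fire_key.hyps(3) indep .
    note sw = fire_key_swap[OF weakly_reachable_invariant(1)[OF IH(2)] t IH(3) this, unfolded IH(4)]
    have g: "weakly_reachable N M0 (fire_key N ?r u k)"
    proof (rule weakly_reachable.fire_key[OF IH(2) fire_key.hyps(2) sw(1)])
      fix k' assume "k' \<in> keys N ?r"
      then obtain v where "k' \<in> history ?r v" using keys_history[OF IH(2)] by blast
      then have "k' \<in> history s v" by (auto split: if_splits)
      then show "k' < k" by (rule less)
    qed
    have h: "history (fire_key N ?r u k) t = history s t - {?k}" using False by simp
    \<comment> \<open>The key \<open>k\<close> exceeds \<open>?k\<close> but belongs to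
      \<open>u\<close>, so \<open>?k\<close> is still above the other keys of
      \<open>t\<close>.\<close>
    have le: "\<forall>k' \<in> history (fire_key N ?r u k) t. k' < ?k"
      using Max_ge[OF fin] unfolding h last_key_def by (auto simp: less_le)
    have "?k \<notin> history (fire_key N ?r u k) t" unfolding h by simp
    note loop = reverse_fire_key[OF weakly_reachable_invariant(1)[OF g] sw(2) weakly_reachable_invariant(2)[OF g] le dead_not_dependent[OF g this]]
    show ?thesis unfolding last unfolding sw(3) loop(2) using loop(3) g sw(2) by blast
  qed
qed

text \<open>Both occurrences are put back on top of \<open>?s2\<close>, the state without them.
  Nothing depends on that of \<open>u\<close>, so the two firings commute; hence reversing
  \<open>u\<close> in \<open>s\<close> leaves \<open>?s2\<close> followed by \<open>t\<close>, and
  reversing \<open>t\<close> then gives \<open>?s2\<close>.\<close>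

lemma reverse_diamond:
  assumes g: "weakly_reachable N M0 s" and "co_enabled N s t" and "co_enabled N s u" and ne: "t \<noteq> u"
  shows "co_enabled N (reverse N s t) u" and "reverse N (reverse N s t) u = reverse N (reverse N s u) t"
proof -
  let ?k = "last_key s t" and ?j = "last_key s u"
  have t: "history s t \<noteq> {}" "\<forall>o'. ((t, ?k), o') \<notin> dependence s"
    and u: "history s u \<noteq> {}" "\<forall>o'. ((u, ?j), o') \<notin> dependence s"
    using assms by (auto simp: co_enabled_def)
  let ?s1 = "reverse N s t" and ?s2 = "reverse N (reverse N s t) u"
  have s1: "weakly_reachable N M0 ?s1" "weakly_enabled N (marking ?s1) t" "fire_key N ?s1 t ?k = s"
    using weakly_reachable_reverse[OF g t] by blast+
  have last: "last_key ?s1 u = ?j" using ne by (simp add: last_key_def)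
  have u1: "history ?s1 u \<noteq> {}" "\<forall>o'. ((u, last_key ?s1 u), o') \<notin> dependence ?s1"
    using u ne unfolding last by auto
  have s2: "co_enabled N ?s1 u" "weakly_reachable N M0 ?s2" "weakly_enabled N (marking ?s2) u" "fire_key N ?s2 u ?j = ?s1"
    using weakly_reachable_reverse[OF s1(1) u1] unfolding last by blast+
  then show "co_enabled N ?s1 u" by blast
  have T: "u \<in> transitions N" using weakly_reachable_invariant(3)[OF g] u(1) by blast
  \<comment> \<open>Had the occurrence of \<open>t\<close> touched that of \<open>u\<close>, the
    pair would be in \<open>dependence s\<close>, against the causal-order condition for
    \<open>u\<close>.\<close>
  have "dependence s = dependence ?s1 \<union> touching N ?s1 t \<times> {(t, ?k)}"
    using s1(3) fire_key_simps(3) by metis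
  then have indep: "(u, ?j) \<notin> touching N ?s1 t" using u(2) by blast
  have "weakly_enabled N (marking (fire_key N ?s2 u ?j)) t" "(u, ?j) \<notin> touching N (fire_key N ?s2 u ?j) t"
    unfolding s2(4) using s1(2) indep .
  note sw = fire_key_swap[OF weakly_reachable_invariant(1)[OF s2(2)] T s2(3) this, unfolded s2(4)]
  let ?m = "fire_key N ?s2 t ?k"
  have fin: "finite (history s v)" for v by (rule weakly_reachable_invariant(2)[OF g])
  have ht: "history ?s2 t = history s t - {?k}" and hu: "history ?s2 u = history s u - {?j}"
    using ne last by auto
  have let': "\<forall>k' \<in> history ?s2 t. k' < ?k"
    using Max_ge[OF fin] unfolding ht last_key_def by (auto simp: less_le)
  have "history ?m u = history s u - {?j}" using ne hu by simp
  then have leu: "\<forall>k' \<in> history ?m u. k' < ?j"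
    using Max_ge[OF fin] by (simp add: less_le last_key_def)
  have finm: "finite (history ?m u)" by (simp add: fin)
  have nt: "?k \<notin> history ?s2 t" and nu: "?j \<notin> history ?s2 u" unfolding ht hu by simp_all
  have nu': "((u, ?j), o') \<notin> dependence ?m \<and> (o', (u, ?j)) \<notin> dependence ?m" for o'
    using dead_not_dependent[OF s2(2) nu, of o'] touching_live[of u ?j N ?s2 t] nu ne by auto
  have pm: "proper (marking ?m)" using proper_fire[OF weakly_reachable_invariant(1)[OF s2(2)] sw(1)] by simp
  have "reverse N s u = ?m"
    using reverse_fire_key(2)[OF pm sw(2) finm leu nu'] sw(3)[of ?k] s1(3) by simp
  moreover have "reverse N ?m t = ?s2"
    using reverse_fire_key(2)[OF weakly_reachable_invariant(1)[OF s2(2)] sw(1) weakly_reachable_invariant(2)[OF s2(2)] let' dead_not_dependent[OF s2(2) nt]] .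
  ultimately show "?s2 = reverse N (reverse N s u) t" by simp
qed

end

section \<open>Equivalence of states\<close>

text \<open>\<open>history_equiv\<close> without paths: live occurrences are the one-element paths,
  dependences the two-element ones, and these determine all others.\<close>

definition renames :: "('a, 'p, 't) rpn \<Rightarrow> (nat \<Rightarrow> nat) \<Rightarrow> ('a, 'p, 't) state \<Rightarrow> ('a, 'p, 't) state \<Rightarrow> bool" where
  "renames N f s s' \<longleftrightarrow> inj_on f (keys N s) \<and> (\<forall>t. history s' t = f ` history s t) \<and>
     dependence s' = map_prod (map_prod id f) (map_prod id f) ` dependence s"

text \<open>Forward actions are tested without the conditions on absent items, so that every
  possible reversal can be followed by its inverse (\<open>can_do_undo\<close>).\<close>

definition can_do :: "('a, 'p, 't) rpn \<Rightarrow> ('a, 'p, 't) state \<Rightarrow> 't action \<Rightarrow> bool" where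
  "can_do N s \<alpha> = (case \<alpha> of Fwd t \<Rightarrow> t \<in> transitions N \<and> weakly_enabled N (marking s) t
     | Rev t \<Rightarrow> t \<in> transitions N \<and> co_enabled N s t)"

definition after :: "('a, 'p, 't) rpn \<Rightarrow> ('a, 'p, 't) state \<Rightarrow> 't action \<Rightarrow> ('a, 'p, 't) state" where
  "after N s \<alpha> = (case \<alpha> of Fwd t \<Rightarrow> fire N s t | Rev t \<Rightarrow> reverse N s t)"

lemma can_do_after_simps [simp]:
  "can_do N s (Fwd t) \<longleftrightarrow> t \<in> transitions N \<and> weakly_enabled N (marking s) t"
  "can_do N s (Rev t) \<longleftrightarrow> t \<in> transitions N \<and> co_enabled N s t"
  "after N s (Fwd t) = fire N s t"
  "after N s (Rev t) = reverse N s t"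
  by (simp_all add: can_do_def after_def)

lemma undo_undo [simp]: "undo (undo \<alpha>) = \<alpha>"
  by (cases \<alpha>) auto

lemma step_can_do: "step N s \<alpha> s' \<Longrightarrow> can_do N s \<alpha> \<and> s' = after N s \<alpha>"
  by (cases \<alpha>) (auto simp: forward_enabled_def weakly_enabled_def)

text \<open>The head of the pending word is its most recent action.\<close>

fun act :: "('a, 'p, 't) rpn \<Rightarrow> ('a, 'p, 't) state \<times> 't action list \<Rightarrow> 't action \<Rightarrow> ('a, 'p, 't) state \<times> 't action list" where
  "act N (s, []) \<alpha> = (if can_do N s \<alpha> then (after N s \<alpha>, []) else (s, [\<alpha>]))"
| "act N (s, \<beta> # u) \<alpha> = (if \<beta> = undo \<alpha> then (s, u) else (s, \<alpha> # \<beta> # u))"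

lemma exec_append: "exec N s (\<rho> @ \<sigma>) s' \<longleftrightarrow> (\<exists>s''. exec N s \<rho> s'' \<and> exec N s'' \<sigma> s')"
  by (induction \<rho> arbitrary: s) auto

text \<open>Pairs are cancelled from the innermost outwards. \<open>comp_left\<close> demands an
  executed prefix, hence \<sigma> and \<rho> are executions; the inverse of \<rho> may fail to be
  executable.\<close>

lemma trace_equiv_undo:
  assumes "exec N s \<sigma> s1" and "exec N s1 \<rho> s2"
  shows "trace_equiv N s (\<sigma> @ \<rho> @ rev (map undo \<rho>)) \<sigma>"
  using assms
proof (induction \<rho> arbitrary: \<sigma> s1)
  case Nil
  then show ?case by (simp add: trace_equiv.refl)
next
  case (Cons \<alpha> \<rho>)
  then obtain s1' where s1': "step N s1 \<alpha> s1'" "exec N s1' \<rho> s2" by auto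
  then have "exec N s (\<sigma> @ [\<alpha>]) s1'" using Cons.prems(1) by (auto simp: exec_append)
  from Cons.IH[OF this s1'(2)]
  have "trace_equiv N s ((\<sigma> @ [\<alpha>] @ \<rho> @ rev (map undo \<rho>)) @ [undo \<alpha>]) ((\<sigma> @ [\<alpha>]) @ [undo \<alpha>])"
    using trace_equiv.comp_right by fastforce
  moreover have "trace_equiv N s (\<sigma> @ [\<alpha>, undo \<alpha>]) (\<sigma> @ [])"
    by (rule trace_equiv.comp_left[OF Cons.prems(1) trace_equiv.cancel])
  ultimately show ?case using trace_equiv.trans by fastforce
qed

context initialised_net
begin

section \<open>Causal paths and renamings\<close>

lemma path_single: "weakly_reachable N M0 s \<Longrightarrow> [(t, k)] \<in> causal_paths N s \<longleftrightarrow> k \<in> history s t"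
  using weakly_reachable_invariant(3)[of s k t] by (auto simp: causal_paths_def)

lemma path_pair: "weakly_reachable N M0 s \<Longrightarrow> [o1, o2] \<in> causal_paths N s \<longleftrightarrow> (o1, o2) \<in> dependence s"
proof -
  assume g: "weakly_reachable N M0 s"
  obtain t k t' k' where o: "o1 = (t, k)" "o2 = (t', k')" by fastforce
  have "(o1, o2) \<in> dependence s \<Longrightarrow> k \<in> history s t \<and> k' \<in> history s t' \<and> t \<in> transitions N \<and> t' \<in> transitions N"
    using weakly_reachable_invariant(4)[OF g, of t k t' k'] weakly_reachable_invariant(3)[OF g, of k t] weakly_reachable_invariant(3)[OF g, of k' t'] o by blast
  then show ?thesis using o by (auto simp: causal_paths_def)
qed

lemma renames_keys: "renames N f s s' \<Longrightarrow> keys N s' = f ` keys N s"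
  by (auto simp: renames_def keys_def)

lemma history_equiv_imp_renames:
  assumes g: "weakly_reachable N M0 s" and g': "weakly_reachable N M0 s'" and "history_equiv N s s'"
  shows "\<exists>f. renames N f s s'"
proof -
  obtain f where inj: "inj_on f (keys N s)" and f: "map (map_prod id f) ` causal_paths N s = causal_paths N s'"
    using assms(3) by (auto simp: history_equiv_def)
  have "k' \<in> history s' t \<longleftrightarrow> k' \<in> f ` history s t" for t k'
  proof -
    have "k' \<in> history s' t \<longleftrightarrow> [(t, k')] \<in> map (map_prod id f) ` causal_paths N s"
      unfolding f path_single[OF g'] ..
    also have "\<dots> \<longleftrightarrow> (\<exists>k. [(t, k)] \<in> causal_paths N s \<and> k' = f k)" (is "?L \<longleftrightarrow> ?R")
    proof
      assume ?L
      then obtain \<pi> where \<pi>: "\<pi> \<in> causal_paths N s" "map (map_prod id f) \<pi> = [(t, k')]" by auto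
      then obtain k where "\<pi> = [(t, k)]" "k' = f k" by auto
      then show ?R using \<pi>(1) by auto
    next
      assume ?R
      then obtain k where k: "[(t, k)] \<in> causal_paths N s" "k' = f k" by blast
      show ?L by (rule image_eqI[OF _ k(1)]) (simp add: k(2))
    qed
    finally show ?thesis unfolding path_single[OF g] by blast
  qed
  then have 1: "history s' t = f ` history s t" for t by blast
  have "(o1', o2') \<in> dependence s' \<longleftrightarrow> (o1', o2') \<in> map_prod (map_prod id f) (map_prod id f) ` dependence s" for o1' o2'
  proof -
    have "(o1', o2') \<in> dependence s' \<longleftrightarrow> [o1', o2'] \<in> map (map_prod id f) ` causal_paths N s"
      unfolding f path_pair[OF g'] ..
    also have "\<dots> \<longleftrightarrow> (\<exists>o1 o2. [o1, o2] \<in> causal_paths N s \<and> o1' = map_prod id f o1 \<and> o2' = map_prod id f o2)" (is "?L \<longleftrightarrow> ?R")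
    proof
      assume ?L
      then obtain \<pi> where \<pi>: "\<pi> \<in> causal_paths N s" "map (map_prod id f) \<pi> = [o1', o2']" by auto
      then obtain o1 o2 where "\<pi> = [o1, o2]" "o1' = map_prod id f o1" "o2' = map_prod id f o2" by blast
      then show ?R using \<pi>(1) by blast
    next
      assume ?R
      then obtain o1 o2 where k: "[o1, o2] \<in> causal_paths N s" "o1' = map_prod id f o1" "o2' = map_prod id f o2" by blast
      show ?L by (rule image_eqI[OF _ k(1)]) (simp add: k(2,3))
    qed
    finally show ?thesis unfolding path_pair[OF g] by force
  qed
  then have "dependence s' = map_prod (map_prod id f) (map_prod id f) ` dependence s"
    by (intro equalityI subrelI) blast+
  with 1 inj show ?thesis unfolding renames_def by blast
qed

lemma renames_sym:
  assumes g: "weakly_reachable N M0 s" and r: "renames N f s s'"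
  shows "renames N (inv_into (keys N s) f) s' s"
proof -
  let ?h = "inv_into (keys N s) f"
  have inj: "inj_on f (keys N s)" using r by (simp add: renames_def)
  have h: "?h (f k) = k" if "k \<in> history s t" for k t
    using inv_into_f_f[OF inj] that keys_history[OF g] by blast
  have "?h ` history s' t = history s t" for t
    using r h[of _ t] by (simp add: renames_def image_image)
  moreover have inv: "map_prod (map_prod id ?h) (map_prod id ?h) (map_prod (map_prod id f) (map_prod id f) d) = d"
    if "d \<in> dependence s" for d
  proof -
    obtain t k t' k' where d: "d = ((t, k), (t', k'))" by (metis prod.collapse)
    then have "k \<in> history s t" "k' \<in> history s t'" using weakly_reachable_invariant(4)[OF g, of t k t' k'] that by simp_all
    then show ?thesis using h d by simp
  qed
  have "map_prod (map_prod id ?h) (map_prod id ?h) ` map_prod (map_prod id f) (map_prod id f) ` dependence s = (\<lambda>d. d) ` dependence s"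
    unfolding image_image by (rule image_cong[OF HOL.refl inv])
  then have "map_prod (map_prod id ?h) (map_prod id ?h) ` dependence s' = dependence s"
    using r by (simp add: renames_def)
  moreover have "inj_on ?h (keys N s')" unfolding renames_keys[OF r] by (rule inj_on_inv_into) simp
  ultimately show ?thesis by (simp add: renames_def)
qed

lemma renames_trans:
  assumes 1: "renames N f s s'" and 2: "renames N f' s' s''"
  shows "renames N (f' \<circ> f) s s''"
proof -
  have "inj_on (f' \<circ> f) (keys N s)"
    using 1 2 renames_keys[OF 1] by (simp add: renames_def comp_inj_on)
  moreover have comp: "map_prod (map_prod id (f' \<circ> f)) (map_prod id (f' \<circ> f)) =
      map_prod (map_prod id f') (map_prod id f') \<circ> map_prod (map_prod id f) (map_prod id f)"
    by (auto simp: fun_eq_iff)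
  have "dependence s'' = map_prod (map_prod id (f' \<circ> f)) (map_prod id (f' \<circ> f)) ` dependence s"
    unfolding comp image_comp[symmetric] using 1 2 by (simp add: renames_def)
  moreover have "history s'' t = (f' \<circ> f) ` history s t" for t
    unfolding image_comp[symmetric] using 1 2 by (simp add: renames_def)
  ultimately show ?thesis unfolding renames_def by blast
qed

lemma renames_paths:
  assumes r: "renames N f s s'"
  shows "map (map_prod id f) ` causal_paths N s \<subseteq> causal_paths N s'"
proof
  fix \<pi>' assume "\<pi>' \<in> map (map_prod id f) ` causal_paths N s"
  then obtain \<pi> where \<pi>: "\<pi> \<in> causal_paths N s" "\<pi>' = map (map_prod id f) \<pi>" by blast
  have "t \<in> transitions N \<and> k \<in> history s' t" if tk: "(t, k) \<in> set \<pi>'" for t k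
  proof -
    obtain k0 where "(t, k0) \<in> set \<pi>" "k = f k0" using tk \<pi>(2) by auto
    then show ?thesis using \<pi>(1) r by (auto simp: causal_paths_def renames_def)
  qed
  moreover have "successively (\<lambda>o1 o2. (o1, o2) \<in> dependence s') \<pi>'"
    unfolding \<pi>(2) successively_map
  proof (rule successively_mono)
    show "successively (\<lambda>o1 o2. (o1, o2) \<in> dependence s) \<pi>" using \<pi>(1) by (simp add: causal_paths_def)
    fix o1 o2 assume "(o1, o2) \<in> dependence s"
    then show "(map_prod id f o1, map_prod id f o2) \<in> dependence s'"
      using r unfolding renames_def by (metis map_prod_simp rev_image_eqI)
  qed
  ultimately show "\<pi>' \<in> causal_paths N s'" by (auto simp: causal_paths_def)
qed

text \<open>One inclusion is \<open>renames_paths\<close>; for the other a path is pulled back along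
  the inverse renaming, which inverts \<open>f\<close> on live keys.\<close>

lemma renames_imp_history_equiv:
  assumes g: "weakly_reachable N M0 s" and g': "weakly_reachable N M0 s'" and r: "renames N f s s'"
  shows "history_equiv N s s'"
proof -
  let ?h = "inv_into (keys N s) f"
  have "causal_paths N s' \<subseteq> map (map_prod id f) ` causal_paths N s"
  proof
    fix \<pi> assume \<pi>: "\<pi> \<in> causal_paths N s'"
    then have 1: "map (map_prod id ?h) \<pi> \<in> causal_paths N s"
      using renames_paths[OF renames_sym[OF g r]] by blast
    have "map_prod id f (map_prod id ?h oc) = oc" if "oc \<in> set \<pi>" for oc
    proof -
      have "snd oc \<in> history s' (fst oc)" using \<pi> that by (auto simp: causal_paths_def)
      then have "snd oc \<in> f ` keys N s"
        using renames_keys[OF r] keys_history[OF g'] by blast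
      then show ?thesis by (cases oc) (simp add: f_inv_into_f)
    qed
    then have "map (map_prod id f) (map (map_prod id ?h) \<pi>) = \<pi>"
      by (simp add: map_idI)
    then show "\<pi> \<in> map (map_prod id f) ` causal_paths N s" using 1 by (metis imageI)
  qed
  then have "map (map_prod id f) ` causal_paths N s = causal_paths N s'"
    using renames_paths[OF r] by blast
  then show ?thesis using r unfolding history_equiv_def renames_def by blast
qed

lemma state_equiv_iff:
  "weakly_reachable N M0 s \<Longrightarrow> weakly_reachable N M0 s' \<Longrightarrow>
    state_equiv N s s' \<longleftrightarrow> marking s = marking s' \<and> (\<exists>f. renames N f s s')"
  using history_equiv_imp_renames renames_imp_history_equiv unfolding state_equiv_def by blast

lemma renames_id: "renames N id s s"
  by (simp add: renames_def prod.map_id0)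

lemma state_equiv_refl: "weakly_reachable N M0 s \<Longrightarrow> state_equiv N s s"
  using state_equiv_iff renames_id by blast

lemma state_equiv_sym: "weakly_reachable N M0 s \<Longrightarrow> weakly_reachable N M0 s' \<Longrightarrow> state_equiv N s s' \<Longrightarrow> state_equiv N s' s"
  using state_equiv_iff renames_sym by metis

lemma state_equiv_trans:
  assumes "weakly_reachable N M0 s" and "weakly_reachable N M0 s'" and "weakly_reachable N M0 s''"
    and "state_equiv N s s'" and "state_equiv N s' s''"
  shows "state_equiv N s s''"
proof -
  obtain f f' where "renames N f s s'" "renames N f' s' s''"
    using assms state_equiv_iff by blast
  then have "renames N (f' \<circ> f) s s''" by (rule renames_trans)
  then show ?thesis using assms state_equiv_iff by auto
qed

text \<open>\<open>f\<close> is extended by sending new key to new key, which keeps it injective as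
  both are fresh. \<open>touching\<close> sees only the marking, which is shared, and the live
  occurrences, which correspond.\<close>

lemma renames_fire_key:
  assumes g: "weakly_reachable N M0 s" and r: "renames N f s s'" and M: "marking s = marking s'"
    and t: "t \<in> transitions N" and k: "k \<notin> keys N s" and k': "k' \<notin> keys N s'"
  shows "renames N (f(k := k')) (fire_key N s t k) (fire_key N s' t k')"
proof -
  let ?f = "f(k := k')"
  have old: "?f j = f j" if "j \<in> history s u" for j u
    using that k keys_history[OF g] by auto
  have keys: "keys N (fire_key N s t k) = insert k (keys N s)" using t by (auto simp: keys_def)
  have "inj_on f (keys N s)" using r by (simp add: renames_def)
  then have "inj_on ?f (keys N s)" using k by (auto simp: inj_on_def)
  moreover have "?f ` keys N s = keys N s'" unfolding renames_keys[OF r] using k by auto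
  ultimately have "inj_on ?f (keys N (fire_key N s t k))" unfolding keys using k k' by auto
  moreover have im: "?f ` history s u = history s' u" for u
  proof -
    have "?f ` history s u = f ` history s u" by (rule image_cong[OF HOL.refl old])
    then show ?thesis using r by (simp add: renames_def)
  qed
  then have "history (fire_key N s' t k') u = ?f ` history (fire_key N s t k) u" for u
    by (cases "u = t") (simp_all del: fun_upd_apply add: fun_upd_same fun_upd_other)
  moreover have "dependence (fire_key N s' t k') = map_prod (map_prod id ?f) (map_prod id ?f) ` dependence (fire_key N s t k)"
  proof -
    have "map_prod (map_prod id ?f) (map_prod id ?f) d = map_prod (map_prod id f) (map_prod id f) d"
      if "d \<in> dependence s" for d
    proof -
      obtain u j u' j' where d: "d = ((u, j), (u', j'))" by (metis prod.collapse)
      then have "j \<in> history s u" "j' \<in> history s u'" using weakly_reachable_invariant(4)[OF g, of u j u' j'] that by simp_all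
      then show ?thesis using old d by simp
    qed
    then have 1: "map_prod (map_prod id ?f) (map_prod id ?f) ` dependence s = dependence s'"
      using r by (simp add: renames_def)
    have 2: "map_prod id ?f ` touching N s t = touching N s' t"
    proof (intro set_eqI iffI)
      fix oc assume "oc \<in> map_prod id ?f ` touching N s t"
      then obtain u j where j: "(u, j) \<in> touching N s t" "oc = (u, ?f j)" by auto
      have "?f j \<in> history s' u" unfolding im[of u, symmetric] by (rule imageI[OF touching_live[OF j(1)]])
      then show "oc \<in> touching N s' t" using j M by (simp add: touching_def del: fun_upd_apply)
    next
      fix oc assume oc: "oc \<in> touching N s' t"
      obtain u j' where u: "oc = (u, j')" by (cases oc)
      then have "j' \<in> ?f ` history s u" unfolding im[of u] using oc by (auto intro: touching_live)
      then obtain j where j: "j \<in> history s u" "j' = ?f j" by blast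
      then have "(u, j) \<in> touching N s t" using oc u M by (simp add: touching_def)
      then show "oc \<in> map_prod id ?f ` touching N s t" by (rule rev_image_eqI) (simp add: u j(2))
    qed
    have "map_prod (map_prod id ?f) (map_prod id ?f) ` (touching N s t \<times> {(t, k)}) = touching N s' t \<times> {(t, k')}"
      unfolding 2[symmetric] by (auto simp del: fun_upd_apply simp add: fun_upd_same intro!: rev_image_eqI)
    then show ?thesis using 1 by (simp add: image_Un)
  qed
  ultimately show ?thesis by (simp add: renames_def)
qed

text \<open>Occurrences of a transition that uses tokens are linearly ordered by dependence, so renamings
  preserve its last key. Occurrences of a transition without tokens are isolated, so their keys can
  be exchanged.\<close>

lemma renames_last_key:
  assumes g: "weakly_reachable N M0 s" and g': "weakly_reachable N M0 s'" and r: "renames N f s s'" and ne: "history s t \<noteq> {}"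
  shows "\<exists>f'. renames N f' s s' \<and> f' (last_key s t) = last_key s' t"
proof (cases "f (last_key s t) = last_key s' t")
  case False
  let ?k = "last_key s t"
  have fin: "finite (history s t)" "finite (history s' t)" using weakly_reachable_invariant(2) g g' by blast+
  have H': "history s' u = f ` history s u" for u using r by (simp add: renames_def)
  have k: "?k \<in> history s t" using Max_in[OF fin(1) ne] by (simp add: last_key_def)
  have "last_key s' t \<in> history s' t" using Max_in[OF fin(2)] ne H'[of t] by (simp add: last_key_def)
  then obtain j where j: "j \<in> history s t" "f j = last_key s' t" using H'[of t] by auto
  have "j < ?k" using Max_ge[OF fin(1) j(1)] False j(2) by (auto simp: last_key_def less_le)
  \<comment> \<open>For a transition with tokens the dependence between its occurrences would force
    \<open>f j < f ?k\<close>, but \<open>f j\<close> is the last key of \<open>t\<close> in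
    \<open>s'\<close>.\<close>
  have isolated: "used N t = {}"
  proof (rule ccontr)
    assume "used N t \<noteq> {}"
    then have "((t, j), (t, ?k)) \<in> dependence s" using weakly_reachable_invariant(6)[OF g _ j(1) k \<open>j < ?k\<close>] by blast
    then have "((t, f j), (t, f ?k)) \<in> dependence s'"
      using r unfolding renames_def by (metis (no_types, lifting) id_apply map_prod_simp rev_image_eqI)
    then have "f j < f ?k" using weakly_reachable_invariant(4)[OF g'] by blast
    moreover have "f ?k \<le> last_key s' t" using Max_ge[OF fin(2)] k H'[of t] by (simp add: last_key_def)
    ultimately show False using j(2) by simp
  qed
  \<comment> \<open>The values of \<open>f\<close> at \<open>?k\<close> and \<open>j\<close> are
    exchanged. Both keys belong to \<open>t\<close> alone, which takes part in no dependence, so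
    histories and dependences keep their images.\<close>
  let ?f = "f(?k := f j, j := f ?k)"
  have only_t: "u = t" if "i \<in> history s u" "i = ?k \<or> i = j" for u i
    using weakly_reachable_invariant(5)[OF g, of i u t] that k j(1) by blast
  have inj: "inj_on f (keys N s)" using r by (simp add: renames_def)
  have kk: "?k \<in> keys N s" "j \<in> keys N s" using k j(1) keys_history[OF g] by blast+
  have "inj_on ?f (keys N s)"
  proof (rule inj_onI)
    fix x y assume "x \<in> keys N s" "y \<in> keys N s" "?f x = ?f y"
    then show "x = y"
      using inj_on_eq_iff[OF inj] kk by (auto simp: fun_upd_apply split: if_splits)
  qed
  moreover have "history s' u = ?f ` history s u" for u
  proof (cases "u = t")
    case True
    have "?f ` history s t = ?f ` ({?k, j} \<union> (history s t - {?k, j}))" using k j(1) by (simp add: Un_absorb1 insert_absorb)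
    also have "\<dots> = {f ?k, f j} \<union> f ` (history s t - {?k, j})"
      using \<open>j < ?k\<close> by (auto simp: image_Un)
    also have "\<dots> = f ` history s t" using k j(1) by auto
    finally show ?thesis using H' True by simp
  next
    case False
    have "?f ` history s u = f ` history s u"
      by (rule image_cong[OF HOL.refl]) (use only_t False in auto)
    then show ?thesis using H' by simp
  qed
  moreover have "map_prod (map_prod id ?f) (map_prod id ?f) d = map_prod (map_prod id f) (map_prod id f) d"
    if "d \<in> dependence s" for d
  proof -
    obtain u i u' i' where d: "d = ((u, i), (u', i'))" by (metis prod.collapse)
    then have "i \<in> history s u" "i' \<in> history s u'" "used N u \<noteq> {}" "used N u' \<noteq> {}"
      using weakly_reachable_invariant(4,7)[OF g, of u i u' i'] that by simp_all
    then have "i \<noteq> ?k" "i \<noteq> j" "i' \<noteq> ?k" "i' \<noteq> j" using only_t isolated by blast+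
    then show ?thesis using d by simp
  qed
  then have "dependence s' = map_prod (map_prod id ?f) (map_prod id ?f) ` dependence s"
    using r by (simp add: renames_def)
  ultimately have "renames N ?f s s'" by (simp add: renames_def)
  moreover have "?f ?k = last_key s' t" using j(2) \<open>j < ?k\<close> by simp
  ultimately show ?thesis by blast
qed (use r in blast)

text \<open>Once the renaming is adjusted by \<open>renames_last_key\<close>, both states lose
  corresponding occurrences. Hence the renaming of the results need not be the given
  \<open>f\<close>.\<close>

lemma renames_reverse:
  assumes g: "weakly_reachable N M0 s" and g': "weakly_reachable N M0 s'" and r: "renames N f s s'" and M: "marking s = marking s'"
    and co: "co_enabled N s t"
  shows "co_enabled N s' t" and "\<exists>f. renames N f (reverse N s t) (reverse N s' t)"
proof -
  have ne: "history s t \<noteq> {}" using co by (simp add: co_enabled_def)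
  obtain f where r: "renames N f s s'" and last: "f (last_key s t) = last_key s' t"
    using renames_last_key[OF g g' r ne] by blast
  let ?k = "last_key s t"
  have inj: "inj_on f (keys N s)" using r by (simp add: renames_def)
  have H': "history s' u = f ` history s u" for u using r by (simp add: renames_def)
  have k: "?k \<in> keys N s" using Max_in[OF weakly_reachable_invariant(2)[OF g] ne] keys_history[OF g] by (auto simp: last_key_def)
  have eq: "f i = f ?k \<longleftrightarrow> i = ?k" if "i \<in> history s u" for i u
  proof -
    have "i \<in> keys N s" using that keys_history[OF g] by blast
    then show ?thesis using inj k by (auto dest: inj_onD)
  qed
  have D': "dependence s' = map_prod (map_prod id f) (map_prod id f) ` dependence s" using r by (simp add: renames_def)
  have out: "((t, f ?k), o') \<notin> dependence s'" for o'
  proof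
    assume "((t, f ?k), o') \<in> dependence s'"
    then obtain i u i' where d: "((t, i), (u, i')) \<in> dependence s" "f i = f ?k" unfolding D' by auto
    then have "i = ?k" using eq weakly_reachable_invariant(4)[OF g d(1)] by blast
    then show False using d(1) co by (auto simp: co_enabled_def)
  qed
  then show "co_enabled N s' t"
    using co ne H'[of t] M unfolding co_enabled_def last by simp
  have sub: "keys N (reverse N s t) \<subseteq> keys N s" by (auto simp: keys_def split: if_splits)
  have "history (reverse N s' t) u = f ` history (reverse N s t) u" for u
  proof (cases "u = t")
    case True
    have "f ` (history s t - {?k}) = f ` history s t - {f ?k}" using eq[of _ t] by auto
    then show ?thesis using True H' last by simp
  qed (simp add: H')
  moreover have "dependence (reverse N s' t) = map_prod (map_prod id f) (map_prod id f) ` dependence (reverse N s t)"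
  proof -
    have pres: "map_prod id f oc = (t, f ?k) \<longleftrightarrow> oc = (t, ?k)" if "snd oc \<in> history s (fst oc)" for oc
      using eq[OF that] by (cases oc) auto
    have live: "snd o1 \<in> history s (fst o1) \<and> snd o2 \<in> history s (fst o2)" if "(o1, o2) \<in> dependence s" for o1 o2
      using weakly_reachable_invariant(4)[OF g, of "fst o1" "snd o1" "fst o2" "snd o2"] that by simp
    have "d \<in> dependence (reverse N s' t) \<longleftrightarrow> d \<in> map_prod (map_prod id f) (map_prod id f) ` dependence (reverse N s t)" for d
    proof
      assume "d \<in> dependence (reverse N s' t)"
      then have d: "d \<in> dependence s'" "fst d \<noteq> (t, f ?k)" "snd d \<noteq> (t, f ?k)" by (auto simp: last)
      then obtain o1 o2 where o: "(o1, o2) \<in> dependence s" "d = (map_prod id f o1, map_prod id f o2)" unfolding D' by auto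
      then have "(o1, o2) \<in> dependence (reverse N s t)"
        using d live[OF o(1)] pres[of o1] pres[of o2] by simp
      then show "d \<in> map_prod (map_prod id f) (map_prod id f) ` dependence (reverse N s t)"
        by (rule rev_image_eqI) (simp add: o(2))
    next
      assume "d \<in> map_prod (map_prod id f) (map_prod id f) ` dependence (reverse N s t)"
      then obtain o1 o2 where o: "(o1, o2) \<in> dependence (reverse N s t)" "d = (map_prod id f o1, map_prod id f o2)" by auto
      then have o': "(o1, o2) \<in> dependence s" "o1 \<noteq> (t, ?k)" "o2 \<noteq> (t, ?k)" by auto
      then have "d \<in> dependence s'" unfolding D' using o(2) by (auto intro: rev_image_eqI)
      then show "d \<in> dependence (reverse N s' t)"
        using o' o(2) live[OF o'(1)] pres[of o1] pres[of o2] by (simp add: last)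
    qed
    then show ?thesis by blast
  qed
  ultimately have "renames N f (reverse N s t) (reverse N s' t)"
    using inj_on_subset[OF inj sub] unfolding renames_def by blast
  then show "\<exists>f. renames N f (reverse N s t) (reverse N s' t)" by blast
qed


section \<open>Single actions up to equivalence\<close>

lemma finite_keys: "weakly_reachable N M0 s \<Longrightarrow> finite (keys N s)"
  using rpn weakly_reachable_invariant(2) by (auto simp: keys_def is_rpn_def)

lemma next_key_fresh:
  assumes "weakly_reachable N M0 s" and "k \<in> keys N s"
  shows "k < next_key N s"
proof -
  have "k \<le> Max (insert 0 (keys N s))"
    by (rule Max_ge) (use finite_keys[OF assms(1)] assms(2) in auto)
  then show ?thesis by (simp add: next_key_def)
qed

text \<open>All live keys are below \<open>next_key N s\<close>, so \<open>causes\<close> and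
  \<open>touching\<close> coincide.\<close>

lemma fire_eq_fire_key:
  assumes g: "weakly_reachable N M0 s"
  shows "fire N s t = fire_key N s t (next_key N s)"
proof -
  have "k < next_key N s" if "k \<in> history s t'" for k t'
    using that next_key_fresh[OF g] keys_history[OF g] by blast
  then have "causes N s t = touching N s t" unfolding causes_def touching_def by blast
  then show ?thesis by (simp add: fire_def fire_key_def)
qed

lemma weakly_reachable_after:
  assumes g: "weakly_reachable N M0 s" and en: "can_do N s \<alpha>"
  shows "weakly_reachable N M0 (after N s \<alpha>)"
proof (cases \<alpha>)
  case (Fwd t)
  then show ?thesis
    using en weakly_reachable.fire_key[OF g, of t "next_key N s"] next_key_fresh[OF g] by (simp add: fire_eq_fire_key[OF g])
next
  case (Rev t)
  then show ?thesis using en weakly_reachable_reverse[OF g, of t] by (simp add: co_enabled_def)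
qed

lemma can_do_equiv:
  assumes g: "weakly_reachable N M0 s" and g': "weakly_reachable N M0 s'" and eq: "state_equiv N s s'" and en: "can_do N s \<alpha>"
  shows "can_do N s' \<alpha>" and "state_equiv N (after N s \<alpha>) (after N s' \<alpha>)"
proof -
  obtain f where M: "marking s = marking s'" and f: "renames N f s s'"
    using eq state_equiv_iff[OF g g'] by blast
  have "can_do N s' \<alpha> \<and> marking (after N s \<alpha>) = marking (after N s' \<alpha>) \<and> (\<exists>f. renames N f (after N s \<alpha>) (after N s' \<alpha>))"
  proof (cases \<alpha>)
    case (Fwd t)
    have "next_key N s \<notin> keys N s" "next_key N s' \<notin> keys N s'"
      using next_key_fresh g g' by blast+
    moreover have "t \<in> transitions N" using en Fwd by simp
    ultimately have "\<exists>f. renames N f (fire N s t) (fire N s' t)"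
      unfolding fire_eq_fire_key[OF g] fire_eq_fire_key[OF g'] using renames_fire_key[OF g f M] by blast
    then show ?thesis using en Fwd M by (simp add: fire_def)
  next
    case (Rev t)
    then have "co_enabled N s t" using en by simp
    then show ?thesis using renames_reverse[OF g g' f M] Rev en M by simp
  qed
  then show "can_do N s' \<alpha>" "state_equiv N (after N s \<alpha>) (after N s' \<alpha>)"
    using state_equiv_iff[OF weakly_reachable_after[OF g en] weakly_reachable_after[OF g']] by blast+
qed

lemma reverse_fire:
  assumes g: "weakly_reachable N M0 s" and en: "can_do N s (Fwd t)"
  shows "co_enabled N (fire N s t) t" and "reverse N (fire N s t) t = s"
proof -
  let ?k = "next_key N s"
  have less: "\<forall>k'\<in>history s t. k' < ?k" using next_key_fresh[OF g] keys_history[OF g] by blast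
  then have "?k \<notin> history s t" by blast
  then show "co_enabled N (fire N s t) t" "reverse N (fire N s t) t = s"
    unfolding fire_eq_fire_key[OF g]
    using reverse_fire_key(2,3)[OF weakly_reachable_invariant(1)[OF g] _ weakly_reachable_invariant(2)[OF g] less dead_not_dependent[OF g]] en
    by simp_all
qed

text \<open>Firing and reversing restores the state exactly. Reversing and firing again assigns the
  next key, which may differ from the old one, so the state is restored only up to renaming.\<close>

lemma can_do_undo:
  assumes g: "weakly_reachable N M0 s" and en: "can_do N s \<alpha>"
  shows "can_do N (after N s \<alpha>) (undo \<alpha>)" and "state_equiv N (after N (after N s \<alpha>) (undo \<alpha>)) s"
proof -
  have "can_do N (after N s \<alpha>) (undo \<alpha>) \<and> state_equiv N (after N (after N s \<alpha>) (undo \<alpha>)) s"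
  proof (cases \<alpha>)
    case (Fwd t)
    then show ?thesis using reverse_fire[OF g, of t] en state_equiv_refl[OF g] by simp
  next
    case (Rev t)
    let ?r = "reverse N s t" and ?k = "last_key s t"
    have "history s t \<noteq> {}" "\<forall>o'. ((t, ?k), o') \<notin> dependence s" and t: "t \<in> transitions N"
      using en Rev by (auto simp: co_enabled_def)
    from weakly_reachable_reverse[OF g this(1,2)]
    have r: "weakly_reachable N M0 ?r" "weakly_enabled N (marking ?r) t" "fire_key N ?r t ?k = s" by blast+
    have "?k \<in> history s t" using Max_in[OF weakly_reachable_invariant(2)[OF g] \<open>history s t \<noteq> {}\<close>] by (simp add: last_key_def)
    then have "?k \<notin> history ?r v" for v
      using weakly_reachable_invariant(5)[OF g, of ?k t v] by (cases "v = t") auto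
    then have "?k \<notin> keys N ?r" unfolding keys_def by blast
    moreover have "next_key N ?r \<notin> keys N ?r" using next_key_fresh[OF r(1)] by blast
    \<comment> \<open>Firing \<open>t\<close> in \<open>?r\<close> with the next key is compared
      with firing it with the old key \<open>?k\<close>, which gives back \<open>s\<close>.\<close>
    ultimately have "renames N (id(next_key N ?r := ?k)) (fire N ?r t) s"
      using renames_fire_key[OF r(1) renames_id HOL.refl t, of "next_key N ?r" ?k] r(3)
      by (simp add: fire_eq_fire_key[OF r(1)])
    moreover have "marking (fire N ?r t) = marking s"
      using arg_cong[OF r(3), of marking] by (simp add: fire_def)
    moreover have "weakly_reachable N M0 (fire N ?r t)" using weakly_reachable_after[OF r(1), of "Fwd t"] r(2) t by simp
    ultimately show ?thesis using Rev t r(2) state_equiv_iff[OF _ g] by auto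
  qed
  then show "can_do N (after N s \<alpha>) (undo \<alpha>)" "state_equiv N (after N (after N s \<alpha>) (undo \<alpha>)) s" by blast+
qed

section \<open>An invariant of trace equivalence\<close>

text \<open>The pending word is reduced, and its oldest action, the last element of the list, is
  impossible in the current state.\<close>

definition valid :: "('a, 'p, 't) state \<times> 't action list \<Rightarrow> bool" where
  "valid c \<longleftrightarrow> weakly_reachable N M0 (fst c) \<and> successively (\<lambda>\<beta> \<gamma>. \<beta> \<noteq> undo \<gamma>) (snd c) \<and>
     (snd c \<noteq> [] \<longrightarrow> \<not> can_do N (fst c) (last (snd c)))"

definition sim :: "('a, 'p, 't) state \<times> 't action list \<Rightarrow> ('a, 'p, 't) state \<times> 't action list \<Rightarrow> bool" where
  "sim c d \<longleftrightarrow> state_equiv N (fst c) (fst d) \<and> snd c = snd d"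

lemma act_valid:
  assumes "valid c"
  shows "valid (act N c \<alpha>)"
proof -
  obtain s u where c: "c = (s, u)" by fastforce
  show ?thesis
  proof (cases u)
    case Nil
    then show ?thesis using assms c weakly_reachable_after by (simp add: valid_def)
  next
    case (Cons \<beta> v)
    then show ?thesis using assms c
      by (cases v) (auto simp: valid_def)
  qed
qed

lemma act_sim:
  assumes "valid c" and "valid d" and "sim c d"
  shows "sim (act N c \<alpha>) (act N d \<alpha>)"
proof -
  obtain s s' u where c: "c = (s, u)" "d = (s', u)" using assms(3) by (cases c; cases d) (simp add: sim_def)
  have g: "weakly_reachable N M0 s" "weakly_reachable N M0 s'" using assms c by (simp_all add: valid_def)
  have eq: "state_equiv N s s'" "state_equiv N s' s"
    using assms(3) c state_equiv_sym[OF g] by (simp_all add: sim_def)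
  show ?thesis
  proof (cases u)
    case Nil
    then show ?thesis
      using c can_do_equiv[OF g eq(1), of \<alpha>] can_do_equiv(1)[OF g(2,1) eq(2), of \<alpha>] eq(1) by (auto simp: sim_def)
  next
    case (Cons \<beta> v)
    then show ?thesis using c eq by (simp add: sim_def)
  qed
qed

text \<open>If the action pops a letter of the pending word, its inverse is that letter and must be
  pushed back. When more is pending, reducedness excludes a further cancellation; when nothing is
  left, validity says that the letter cannot be performed.\<close>

lemma act_undo:
  assumes "valid c"
  shows "sim (act N (act N c \<alpha>) (undo \<alpha>)) c"
proof -
  obtain s u where c: "c = (s, u)" by fastforce
  have g: "weakly_reachable N M0 s" using assms c by (simp add: valid_def)
  show ?thesis
  proof (cases u)
    case Nil
    then show ?thesis using c can_do_undo[OF g, of \<alpha>] state_equiv_refl[OF g] by (simp add: sim_def)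
  next
    case (Cons \<beta> v)
    then show ?thesis using c assms state_equiv_refl[OF g]
      by (cases v) (auto simp: sim_def valid_def)
  qed
qed

lemma acts_valid: "valid c \<Longrightarrow> valid (foldl (act N) c \<sigma>)"
  by (induction \<sigma> arbitrary: c) (simp_all add: act_valid)

lemma acts_sim: "valid c \<Longrightarrow> valid d \<Longrightarrow> sim c d \<Longrightarrow> sim (foldl (act N) c \<sigma>) (foldl (act N) d \<sigma>)"
  by (induction \<sigma> arbitrary: c d) (simp_all add: act_valid act_sim)

lemma valid_state: "weakly_reachable N M0 s \<Longrightarrow> valid (s, [])"
  by (simp add: valid_def)

lemma weakly_reachable_step: "weakly_reachable N M0 s \<Longrightarrow> step N s \<alpha> s' \<Longrightarrow> weakly_reachable N M0 s'"
  using step_can_do weakly_reachable_after by metis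

lemma weakly_reachable_exec: "weakly_reachable N M0 s \<Longrightarrow> exec N s \<sigma> s' \<Longrightarrow> weakly_reachable N M0 s'"
  by (induction \<sigma> arbitrary: s) (auto dest: weakly_reachable_step)

lemma acts_exec: "exec N s \<sigma> s' \<Longrightarrow> foldl (act N) (s, []) \<sigma> = (s', [])"
proof (induction \<sigma> arbitrary: s)
  case (Cons \<alpha> \<sigma>)
  then obtain s1 where "step N s \<alpha> s1" "exec N s1 \<sigma> s'" by auto
  then show ?case using Cons.IH step_can_do[of N s \<alpha> s1] by simp
qed simp

lemma sim_sym: "valid c \<Longrightarrow> valid d \<Longrightarrow> sim c d \<Longrightarrow> sim d c"
  using state_equiv_sym by (auto simp: sim_def valid_def)

lemma sim_trans: "valid c \<Longrightarrow> valid d \<Longrightarrow> valid e \<Longrightarrow> sim c d \<Longrightarrow> sim d e \<Longrightarrow> sim c e"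
  using state_equiv_trans[of "fst c" "fst d" "fst e"] by (auto simp: sim_def valid_def)

lemma trace_equiv_sim:
  assumes "trace_equiv N s \<sigma> \<tau>" and "weakly_reachable N M0 s"
  shows "sim (foldl (act N) (s, []) \<sigma>) (foldl (act N) (s, []) \<tau>)"
  using assms
proof induction
  case (refl s \<sigma>)
  then have "valid (foldl (act N) (s, []) \<sigma>)" by (simp add: acts_valid valid_state)
  then show ?case by (simp add: sim_def state_equiv_refl valid_def)
next
  case (sym s \<sigma> \<tau>)
  show ?case
    by (rule sim_sym[OF _ _ sym.IH[OF sym.prems]]) (rule acts_valid[OF valid_state[OF sym.prems]])+
next
  case (trans s \<sigma> \<tau> \<rho>)
  have v: "valid (foldl (act N) (s, []) \<upsilon>)" for \<upsilon> using trans.prems by (simp add: acts_valid valid_state)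
  show ?case by (rule sim_trans[OF v v v trans.IH(1)[OF trans.prems] trans.IH(2)[OF trans.prems]])
next
  \<comment> \<open>Concurrency provides executions in both orders, so nothing becomes
    pending.\<close>
  case (swap s \<alpha> \<beta>)
  then obtain s1 s2 s1' s2' where *: "step N s \<alpha> s1" "step N s1 \<beta> s1'" "step N s \<beta> s2" "step N s2 \<alpha> s2'"
    and eq: "state_equiv N s1' s2'"
    unfolding concurrent_def by blast
  have "exec N s [\<alpha>, \<beta>] s1'" "exec N s [\<beta>, \<alpha>] s2'" using * by auto
  note this[THEN acts_exec]
  then show ?case using eq by (simp only: sim_def fst_conv snd_conv simp_thms)
next
  case (cancel s \<alpha>)
  then show ?case using act_undo[OF valid_state] by simp
next
  \<comment> \<open>The prefix is an execution, so it leads to \<open>s'\<close> with nothing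
    pending, where the induction hypothesis applies.\<close>
  case (comp_left s \<rho> s' \<sigma> \<tau>)
  then show ?case using acts_exec[OF comp_left.hyps(1)] weakly_reachable_exec[OF comp_left.prems comp_left.hyps(1)] by simp
next
  case (comp_right s \<sigma> \<tau> \<rho>)
  then show ?case by (simp add: acts_sim acts_valid valid_state)
qed

section \<open>Reversing everything\<close>

text \<open>Of the final state only the history is constrained, a condition that
  \<open>state_equiv\<close> preserves, as \<open>unwinds_equiv\<close> requires.\<close>

definition unwinds :: "('a, 'p, 't) state \<Rightarrow> 't list \<Rightarrow> bool" where
  "unwinds s ts \<longleftrightarrow> (\<exists>s'. exec N s (map Rev ts) s' \<and> history s' = (\<lambda>_. {}))"

lemma unwinds_Nil: "unwinds s [] \<longleftrightarrow> history s = (\<lambda>_. {})"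
  by (simp add: unwinds_def)

lemma unwinds_Cons:
  "unwinds s (t # ts) \<longleftrightarrow> t \<in> transitions N \<and> co_enabled N s t \<and> unwinds (reverse N s t) ts"
  by (auto simp: unwinds_def)

text \<open>The firings of the sequence are undone, latest first.\<close>

lemma unwinds_exists: "weakly_reachable N M0 s \<Longrightarrow> \<exists>ts. unwinds s ts"
proof (induction rule: weakly_reachable.induct)
  case init
  have "unwinds (initial_state M0) []" by (simp add: unwinds_Nil initial_state_def)
  then show ?case ..
next
  case (fire_key s t k)
  then obtain ts where ts: "unwinds s ts" by blast
  have less: "\<forall>k'\<in>history s t. k' < k"
    using fire_key.hyps(4) keys_history[OF fire_key.hyps(1)] by blast
  then have "k \<notin> history s t" by blast
  note loop = reverse_fire_key[OF weakly_reachable_invariant(1)[OF fire_key.hyps(1)] fire_key.hyps(3) weakly_reachable_invariant(2)[OF fire_key.hyps(1)] less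
      dead_not_dependent[OF fire_key.hyps(1) this]]
  have "unwinds (fire_key N s t k) (t # ts)" unfolding unwinds_Cons loop(2) using loop(3) fire_key.hyps(2) ts by blast
  then show ?case ..
qed

lemma weakly_reachable_reverse_step: "weakly_reachable N M0 s \<Longrightarrow> t \<in> transitions N \<Longrightarrow> co_enabled N s t \<Longrightarrow> weakly_reachable N M0 (reverse N s t)"
  using weakly_reachable_after[of s "Rev t"] by simp

text \<open>Measure for the induction in \<open>unwinds_unique\<close>: its size drops with every
  reversal.\<close>

definition occurrences :: "('a, 'p, 't) state \<Rightarrow> 't occurrence set" where
  "occurrences s = (SIGMA t:transitions N. history s t)"

lemma occurrences_reverse:
  assumes g: "weakly_reachable N M0 s" and t: "t \<in> transitions N" and co: "co_enabled N s t"
  shows "card (occurrences (reverse N s t)) < card (occurrences s)"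
proof (rule psubset_card_mono)
  show "finite (occurrences s)" unfolding occurrences_def
    using rpn weakly_reachable_invariant(2)[OF g] by (auto simp: is_rpn_def)
  have "history s t \<noteq> {}" using co by (simp add: co_enabled_def)
  then have "last_key s t \<in> history s t" using Max_in[OF weakly_reachable_invariant(2)[OF g]] by (simp add: last_key_def)
  then have "(t, last_key s t) \<in> occurrences s - occurrences (reverse N s t)" using t by (simp add: occurrences_def)
  moreover have "occurrences (reverse N s t) \<subseteq> occurrences s" by (auto simp: occurrences_def split: if_splits)
  ultimately show "occurrences (reverse N s t) \<subset> occurrences s" by blast
qed

lemma trace_equiv_Cons:
  "step N s \<alpha> s' \<Longrightarrow> trace_equiv N s' \<sigma> \<tau> \<Longrightarrow> trace_equiv N s (\<alpha> # \<sigma>) (\<alpha> # \<tau>)"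
  using trace_equiv.comp_left[of N s "[\<alpha>]" s' \<sigma> \<tau>] by simp

text \<open>Induction on the number of live occurrences. If the words start with different
  reversals, \<open>reverse_diamond\<close> closes the square; a word \<open>ws\<close> that unwinds
  its far corner links the two words, as the reversals in front of it are concurrent.\<close>

lemma unwinds_unique:
  "weakly_reachable N M0 s \<Longrightarrow> unwinds s ts \<Longrightarrow> unwinds s us \<Longrightarrow> trace_equiv N s (map Rev ts) (map Rev us)"
proof (induction "card (occurrences s)" arbitrary: s ts us rule: less_induct)
  case less
  note g = less.prems(1)
  show ?case
  proof (cases ts)
    case Nil
    \<comment> \<open>With an empty history no reversal is possible, so the other word is empty
      too.\<close>
    then have "us = []" using less.prems
      by (cases us) (auto simp: unwinds_Nil unwinds_Cons co_enabled_def)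
    then show ?thesis using Nil by (simp add: trace_equiv.refl)
  next
    case ts: (Cons t ts')
    then obtain u us' where us: "us = u # us'"
      using less.prems by (cases us) (auto simp: unwinds_Nil unwinds_Cons co_enabled_def)
    have t: "t \<in> transitions N" "co_enabled N s t" "unwinds (reverse N s t) ts'"
      using less.prems(2) ts by (simp_all add: unwinds_Cons)
    have u: "u \<in> transitions N" "co_enabled N s u" "unwinds (reverse N s u) us'"
      using less.prems(3) us by (simp_all add: unwinds_Cons)
    have gt: "weakly_reachable N M0 (reverse N s t)" and gu: "weakly_reachable N M0 (reverse N s u)"
      using weakly_reachable_reverse_step[OF g] t u by blast+
    note IHt = less.hyps[OF occurrences_reverse[OF g t(1,2)] gt t(3)]
    note IHu = less.hyps[OF occurrences_reverse[OF g u(1,2)] gu _ u(3)]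
    have steps: "step N s (Rev t) (reverse N s t)" "step N s (Rev u) (reverse N s u)"
      using t u by simp_all
    show ?thesis
    proof (cases "t = u")
      case True
      then show ?thesis using IHt[of us'] u(3) trace_equiv_Cons[OF steps(1)] ts us by simp
    next
      case False
      let ?m = "reverse N (reverse N s t) u"
      have co: "co_enabled N (reverse N s t) u" and m: "?m = reverse N (reverse N s u) t"
        using reverse_diamond[OF g t(2) u(2) False] by blast+
      have co': "co_enabled N (reverse N s u) t"
        using reverse_diamond(1)[OF g u(2) t(2)] False by blast
      have gm: "weakly_reachable N M0 ?m" by (rule weakly_reachable_reverse_step[OF gt u(1) co])
      obtain ws where ws: "unwinds ?m ws" using unwinds_exists[OF gm] by blast
      have "unwinds (reverse N s t) (u # ws)" using ws u(1) co by (simp add: unwinds_Cons)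
      then have 1: "trace_equiv N s (Rev t # map Rev ts') (Rev t # Rev u # map Rev ws)"
        using trace_equiv_Cons[OF steps(1) IHt[of "u # ws"]] by simp
      have "unwinds (reverse N s u) (t # ws)" using ws t(1) co' m by (simp add: unwinds_Cons)
      then have 2: "trace_equiv N s (Rev u # Rev t # map Rev ws) (Rev u # map Rev us')"
        using trace_equiv_Cons[OF steps(2) IHu[of "t # ws"]] by simp
      have "concurrent N s (Rev t) (Rev u)"
        unfolding concurrent_def
        using t(1,2) u(1,2) co co' state_equiv_refl[OF gm] m by auto
      from trace_equiv.comp_right[OF trace_equiv.swap[OF this], of "map Rev ws"]
      have "trace_equiv N s (Rev t # Rev u # map Rev ws) (Rev u # Rev t # map Rev ws)" by simp
      then show ?thesis using 1 2 ts us trace_equiv.trans by (metis list.simps(9))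
    qed
  qed
qed

text \<open>Induction on \<sigma>. After a forward action, reversing it and then following
  \<open>us\<close> unwinds the new state, and the pair cancels. A reversal followed by a word that
  unwinds the new state unwinds \<open>s\<close>, so \<open>unwinds_unique\<close> compares it with
  \<open>us\<close>.\<close>

lemma exec_unwinds:
  "weakly_reachable N M0 s \<Longrightarrow> exec N s \<sigma> s1 \<Longrightarrow> unwinds s1 ts \<Longrightarrow> unwinds s us \<Longrightarrow>
    trace_equiv N s (\<sigma> @ map Rev ts) (map Rev us)"
proof (induction \<sigma> arbitrary: s us)
  case Nil
  then show ?case by (simp add: unwinds_unique)
next
  case (Cons \<alpha> \<sigma>)
  then obtain s' where s': "step N s \<alpha> s'" "exec N s' \<sigma> s1" by auto
  have g': "weakly_reachable N M0 s'" using weakly_reachable_step[OF Cons.prems(1) s'(1)] .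
  show ?case
  proof (cases \<alpha>)
    case (Fwd t)
    have t: "can_do N s (Fwd t)" "s' = fire N s t" using step_can_do[OF s'(1)] Fwd by simp_all
    have "unwinds s' (t # us)"
      using reverse_fire[OF Cons.prems(1) t(1)] t Cons.prems(4) by (simp add: unwinds_Cons)
    from trace_equiv_Cons[OF s'(1) Cons.IH[OF g' s'(2) Cons.prems(3) this]]
    have "trace_equiv N s (\<alpha> # \<sigma> @ map Rev ts) ([\<alpha>, undo \<alpha>] @ map Rev us)" using Fwd by simp
    moreover have "trace_equiv N s ([\<alpha>, undo \<alpha>] @ map Rev us) ([] @ map Rev us)"
      by (rule trace_equiv.comp_right[OF trace_equiv.cancel])
    ultimately show ?thesis using trace_equiv.trans by fastforce
  next
    case (Rev t)
    obtain vs where vs: "unwinds s' vs" using unwinds_exists[OF g'] by blast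
    have "trace_equiv N s (\<alpha> # \<sigma> @ map Rev ts) (\<alpha> # map Rev vs)"
      by (rule trace_equiv_Cons[OF s'(1) Cons.IH[OF g' s'(2) Cons.prems(3) vs]])
    moreover have "unwinds s (t # vs)" using vs s'(1) Rev by (simp add: unwinds_Cons)
    then have "trace_equiv N s (map Rev (t # vs)) (map Rev us)"
      using unwinds_unique[OF Cons.prems(1)] Cons.prems(4) by blast
    ultimately show ?thesis using Rev trace_equiv.trans by fastforce
  qed
qed

lemma unwinds_equiv:
  "weakly_reachable N M0 s \<Longrightarrow> weakly_reachable N M0 s' \<Longrightarrow> state_equiv N s s' \<Longrightarrow> unwinds s ts \<Longrightarrow> unwinds s' ts"
proof (induction ts arbitrary: s s')
  case Nil
  then show ?case
    using state_equiv_iff[of s s'] by (auto simp: unwinds_Nil renames_def fun_eq_iff)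
next
  case (Cons t ts)
  have t: "t \<in> transitions N" "co_enabled N s t" "unwinds (reverse N s t) ts"
    using Cons.prems(4) by (simp_all add: unwinds_Cons)
  have eq: "co_enabled N s' t" "state_equiv N (reverse N s t) (reverse N s' t)"
    using can_do_equiv[OF Cons.prems(1-3), of "Rev t"] t by simp_all
  have "weakly_reachable N M0 (reverse N s t)" "weakly_reachable N M0 (reverse N s' t)"
    using weakly_reachable_reverse_step Cons.prems(1,2) t(1,2) eq(1) by blast+
  then have "unwinds (reverse N s' t) ts" using Cons.IH eq(2) t(3) by blast
  then show ?case using t(1) eq(1) by (simp add: unwinds_Cons)
qed

lemma trace_equiv_iff:
  assumes g: "weakly_reachable N M0 s" and 1: "exec N s \<sigma>1 s1" and 2: "exec N s \<sigma>2 s2"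
  shows "trace_equiv N s \<sigma>1 \<sigma>2 \<longleftrightarrow> state_equiv N s1 s2"
proof
  assume "trace_equiv N s \<sigma>1 \<sigma>2"
  from trace_equiv_sim[OF this g] show "state_equiv N s1 s2"
    using acts_exec[OF 1] acts_exec[OF 2] by (simp add: sim_def)
next
  assume eq: "state_equiv N s1 s2"
  have g1: "weakly_reachable N M0 s1" and g2: "weakly_reachable N M0 s2" using weakly_reachable_exec[OF g] 1 2 by blast+
  obtain ts us where ts: "unwinds s1 ts" and us: "unwinds s us"
    using unwinds_exists g g1 by blast
  have ts2: "unwinds s2 ts" by (rule unwinds_equiv[OF g1 g2 eq ts])
  let ?R = "map Rev ts"
  let ?R' = "rev (map undo ?R)"
  \<comment> \<open>Both sides are equivalent to \<open>map Rev us\<close>, which unwinds the common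
    start state.\<close>
  have "trace_equiv N s (\<sigma>1 @ ?R) (\<sigma>2 @ ?R)"
    using exec_unwinds[OF g 1 ts us] exec_unwinds[OF g 2 ts2 us] trace_equiv.trans trace_equiv.sym by metis
  from trace_equiv.comp_right[OF this, of ?R']
  have "trace_equiv N s (\<sigma>1 @ ?R @ ?R') (\<sigma>2 @ ?R @ ?R')" by simp
  moreover have "trace_equiv N s (\<sigma>1 @ ?R @ ?R') \<sigma>1" "trace_equiv N s (\<sigma>2 @ ?R @ ?R') \<sigma>2"
    using ts ts2 trace_equiv_undo 1 2 unfolding unwinds_def by blast+
  ultimately show "trace_equiv N s \<sigma>1 \<sigma>2"
    using trace_equiv.trans trace_equiv.sym by metis
qed

end

theorem theorem3p1:
  fixes N :: "('a, 'p, 't) rpn"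
    and M0 :: "('a, 'p) marking"
    and s s1 s2 :: "('a, 'p, 't) state"
    and \<sigma>1 \<sigma>2 :: "'t action list"
  assumes "is_rpn N" and "well_formed N" and "initial_marking N M0"
    and "reachable N M0 s"
    and "exec N s \<sigma>1 s1" and "exec N s \<sigma>2 s2"
  shows "trace_equiv N s \<sigma>1 \<sigma>2 \<longleftrightarrow> state_equiv N s1 s2"
proof -
  interpret initialised_net N M0
    using assms(1-3) by unfold_locales
  obtain \<sigma> where "exec N (initial_state M0) \<sigma> s" using assms(4) by (auto simp: reachable_def)
  then have "weakly_reachable N M0 s" by (rule weakly_reachable_exec[OF weakly_reachable.init])
  then show ?thesis using assms(5,6) by (rule trace_equiv_iff)
qed

end
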